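(* Let $0<\alpha<\beta<\infty$ and $w\in\mathcal W_{\alpha,\beta}$. For every nonnegative measurable function $H:\mathbb R^2\times(0,\infty)^2\to[0,\infty]$, \[ \begin{aligned} &\mathbb E\sum_{z_0,z_1\in M_w}^{\ne} H\bigl(\operatorname{Re}z_0,\operatorname{Re}z_1-\operatorname{Re}z_0,\operatorname{Im}z_0,\operatorname{Im}z_1\bigr)\\ &\quad=\int_{\mathbb R}\int_{\mathbb R}\rho_w^{(2)}(r)\int_{(0,\infty)^2}H(x,r,y_0,y_1)\,\mathsf Q_{w,r}(\mathrm dy_0\,\mathrm dy_1)\,\mathrm dr\,\mathrm dx . \end{aligned} \] Moreover, $r\mapsto\mathsf Q_{w,r}$ is continuous in total variation on $\mathbb R$ and is the unique weakly continuous version of the conditional height kernel in this disintegration; that is, any weakly continuous family $(\mathsf Q'_r)_{r\in\mathbb R}$ of probability measures on $(0,\infty)^2$ for which the displayed identity holds for all such $H$ with $\mathsf Q'_r$ in place of $\mathsf Q_{w,r}$ satisfies $\mathsf Q'_r=\mathsf Q_{w,r}$ for every $r\in\mathbb R$.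
   Context: $\mathbb H=\{x+iy:x\in\mathbb R,\ y>0\}$ with planar Lebesgue measure $\mathrm dA$. $Z_{\mathbb H}$ is the determinantal point process on $\mathbb H$ with kernel $K_{\mathbb H}(z,\zeta)=-\frac{1}{\pi(z-\overline\zeta)^2}$ relative to $\mathrm dA$, i.e. for every $k\ge1$ its $k$-th factorial moment measure has density $\det[K_{\mathbb H}(z_i,z_j)]_{i,j=1}^k$ with respect to $\mathrm dA^{\otimes k}$. $\mathcal W_{\alpha,\beta}$ is the set of Borel functions $w:(0,\infty)\to[0,1]$ with $w(y)=0$ for $y\notin[\alpha,\beta]$ and $\int_\alpha^\beta w(y)\,\mathrm dy>0$. $M_w$ is obtained from $Z_{\mathbb H}$ by independently retaining each point $z=x+iy$ with probability $w(y)$. The sum $\sum^{\ne}$ is over ordered pairs of distinct points. Set $\lambda_w=\frac1{4\pi}\int_0^\infty w(y)y^{-2}\,\mathrm dy$ and \[ \rho_w^{(2)}(r)=\lambda_w^2-\frac1{\pi^2}\int_0^\infty\int_0^\infty\frac{w(y)w(v)}{(r^2+(y+v)^2)^2}\,\mathrm dy\,\mathrm dv ,\qquad r\in\mathbb R, \] which is strictly positive (it is the two-point factorial moment density, as a function of $r=x_2-x_1$, of the projected process $\sum_{z\in M_w}\delta_{\operatorname{Re}z}$). For $r\in\mathbb R$, define the probability measure on $(0,\infty)^2$ \[ \mathsf Q_{w,r}(\mathrm dy_0\,\mathrm dy_1)=\frac{w(y_0)w(y_1)}{\rho_w^{(2)}(r)}\left[\frac{1}{16\pi^2y_0^2y_1^2}-\frac{1}{\pi^2\left(r^2+(y_0+y_1)^2\right)^2}\right]\mathrm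 dy_0\,\mathrm dy_1 . \] *)

theory Defs
  imports "HOL-Probability.Probability" "Jordan_Normal_Form.Determinant"
begin

definition half_plane :: "complex set" where
  "half_plane = {z. 0 < Im z}"

section \<open>Point processes\<close>

(* Point processes are random locally finite subsets of D (all processes considered are simple);
   measurability is that of the counts of Borel sets. *)
definition point_process_on :: "'a measure \<Rightarrow> complex set \<Rightarrow> ('a \<Rightarrow> complex set) \<Rightarrow> bool" where
  "point_process_on P D Z \<longleftrightarrow>
     prob_space P \<and>
     (\<forall>\<omega>\<in>space P. Z \<omega> \<subseteq> D \<and> (\<forall>C. compact C \<and> C \<subseteq> D \<longrightarrow> finite (Z \<omega> \<inter> C))) \<and>
     (\<forall>B\<in>sets borel. B \<subseteq> D \<longrightarrow>
        (\<lambda>\<omega>. emeasure (count_space UNIV) (Z \<omega> \<inter> B)) \<in> borel_measurable P)"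

definition distinct_tuples :: "nat \<Rightarrow> complex set \<Rightarrow> (nat \<Rightarrow> complex) set" where
  "distinct_tuples k S = {z \<in> {..<k} \<rightarrow>\<^sub>E S. inj_on z {..<k}}"

definition factorial_moment ::
    "'a measure \<Rightarrow> ('a \<Rightarrow> complex set) \<Rightarrow> nat \<Rightarrow> (nat \<Rightarrow> complex) set \<Rightarrow> ennreal" where
  "factorial_moment P Z k B =
     (\<integral>\<^sup>+ \<omega>. emeasure (count_space UNIV) (distinct_tuples k (Z \<omega>) \<inter> B) \<partial>P)"

(* For a Hermitian kernel the determinant is real, so Re discards nothing. *)
definition determinantal_process ::
    "'a measure \<Rightarrow> complex set \<Rightarrow> (complex \<Rightarrow> complex \<Rightarrow> complex) \<Rightarrow> ('a \<Rightarrow> complex set) \<Rightarrow> bool" where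
  "determinantal_process P D K Z \<longleftrightarrow>
     point_process_on P D Z \<and>
     (\<forall>k\<ge>1. \<forall>B\<in>sets (PiM {..<k} (\<lambda>_. restrict_space lborel D)).
        factorial_moment P Z k B =
          (\<integral>\<^sup>+ z\<in>B. ennreal (Re (Determinant.det (Matrix.mat k k (\<lambda>(i, j). K (z i) (z j)))))
             \<partial>PiM {..<k} (\<lambda>_. restrict_space lborel D)))"

definition K_H :: "complex \<Rightarrow> complex \<Rightarrow> complex" where
  "K_H z \<zeta> = - 1 / (of_real pi * (z - cnj \<zeta>)\<^sup>2)"

(* M arises from Z by retaining each z independently with probability p z: the points of Z are
   listed without repetition as X 0, X 1, ... (N of them, N possibly infinite), U is an i.i.d.
   sequence of uniform marks independent of (N, X), and X n is retained iff U n \<le> p (X n).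
   Measurability of the U n is part of indep_vars. indep_var would force (N, X) and U to have the
   same value type, hence independence of the generated sigma-algebras. *)
definition independent_thinning ::
    "'a measure \<Rightarrow> ('a \<Rightarrow> complex set) \<Rightarrow> (complex \<Rightarrow> real) \<Rightarrow> ('a \<Rightarrow> complex set) \<Rightarrow> bool" where
  "independent_thinning P Z p M \<longleftrightarrow>
     (\<exists>(N :: 'a \<Rightarrow> enat) (X :: nat \<Rightarrow> 'a \<Rightarrow> complex) (U :: nat \<Rightarrow> 'a \<Rightarrow> real).
        (\<forall>\<omega>\<in>space P. inj_on (\<lambda>n. X n \<omega>) {n. enat n < N \<omega>} \<and>
           Z \<omega> = {X n \<omega> | n. enat n < N \<omega>}) \<and>
        prob_space.indep_vars P (\<lambda>_. borel) U UNIV \<and>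
        (\<forall>n. distr P borel (U n) = uniform_measure lborel {0..1}) \<and>
        N \<in> P \<rightarrow>\<^sub>M count_space UNIV \<and> (\<forall>n. X n \<in> P \<rightarrow>\<^sub>M borel) \<and>
        prob_space.indep_set P
          (sets (vimage_algebra (space P) (\<lambda>\<omega>. (N \<omega>, \<lambda>n. X n \<omega>))
             (count_space UNIV \<Otimes>\<^sub>M PiM UNIV (\<lambda>_. borel))))
          (sets (vimage_algebra (space P) (\<lambda>\<omega> n. U n \<omega>) (PiM UNIV (\<lambda>_. borel)))) \<and>
        (\<forall>\<omega>\<in>space P. M \<omega> = {X n \<omega> | n. enat n < N \<omega> \<and> U n \<omega> \<le> p (X n \<omega>)}))"

section \<open>Weights and the pair kernel\<close>

(* Weights are functions on (0, \<infinity>); their values elsewhere are irrelevant. *)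
definition weights :: "real \<Rightarrow> real \<Rightarrow> (real \<Rightarrow> real) set" where
  "weights \<alpha> \<beta> =
     {w. w \<in> borel_measurable (restrict_space borel {0<..}) \<and>
         (\<forall>y>0. 0 \<le> w y \<and> w y \<le> 1) \<and>
         (\<forall>y>0. y \<notin> {\<alpha>..\<beta>} \<longrightarrow> w y = 0) \<and>
         (LBINT y:{\<alpha>..\<beta>}. w y) > 0}"

definition intensity :: "(real \<Rightarrow> real) \<Rightarrow> real" where
  "intensity w = 1 / (4 * pi) * (LBINT y:{0<..}. w y / y\<^sup>2)"

definition rho2 :: "(real \<Rightarrow> real) \<Rightarrow> real \<Rightarrow> real" where
  "rho2 w r = (intensity w)\<^sup>2 -
     1 / pi\<^sup>2 * (LBINT y:{0<..}. LBINT v:{0<..}. w y * w v / (r\<^sup>2 + (y + v)\<^sup>2)\<^sup>2)"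

abbreviation quadrant :: "(real \<times> real) set" where
  "quadrant \<equiv> {0<..} \<times> {0<..}"

definition Q :: "(real \<Rightarrow> real) \<Rightarrow> real \<Rightarrow> (real \<times> real) measure" where
  "Q w r = density (restrict_space lborel quadrant)
     (\<lambda>(y0, y1). ennreal (w y0 * w y1 / rho2 w r *
        (1 / (16 * pi\<^sup>2 * y0\<^sup>2 * y1\<^sup>2) - 1 / (pi\<^sup>2 * (r\<^sup>2 + (y0 + y1)\<^sup>2)\<^sup>2))))"

section \<open>Disintegration and continuity\<close>

definition pair_disintegration ::
    "'a measure \<Rightarrow> ('a \<Rightarrow> complex set) \<Rightarrow> (real \<Rightarrow> real) \<Rightarrow> (real \<Rightarrow> (real \<times> real) measure) \<Rightarrow> bool" where
  "pair_disintegration P M w q \<longleftrightarrow>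
     (\<forall>H :: real \<times> real \<times> real \<times> real \<Rightarrow> ennreal.
        H \<in> borel_measurable (restrict_space borel (UNIV \<times> UNIV \<times> quadrant)) \<longrightarrow>
        (\<integral>\<^sup>+ \<omega>. (\<integral>\<^sup>+ (z0, z1). H (Re z0, Re z1 - Re z0, Im z0, Im z1)
              \<partial>count_space {(z0, z1). z0 \<in> M \<omega> \<and> z1 \<in> M \<omega> \<and> z0 \<noteq> z1}) \<partial>P) =
        (\<integral>\<^sup>+ x. \<integral>\<^sup>+ r. ennreal (rho2 w r) * (\<integral>\<^sup>+ (y0, y1). H (x, r, y0, y1) \<partial>q r)
              \<partial>lborel \<partial>lborel))"

definition prob_family_on :: "'b::topological_space set \<Rightarrow> (real \<Rightarrow> 'b measure) \<Rightarrow> bool" where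
  "prob_family_on S q \<longleftrightarrow>
     (\<forall>r. prob_space (q r) \<and> space (q r) = S \<and> sets (q r) = sets (restrict_space borel S))"

definition weakly_continuous_on :: "'b::topological_space set \<Rightarrow> (real \<Rightarrow> 'b measure) \<Rightarrow> bool" where
  "weakly_continuous_on S q \<longleftrightarrow>
     (\<forall>f :: 'b \<Rightarrow> real. continuous_on S f \<and> bounded (f ` S) \<longrightarrow>
        continuous_on UNIV (\<lambda>r. \<integral>y. f y \<partial>q r))"

definition tv_dist :: "'b measure \<Rightarrow> 'b measure \<Rightarrow> real" where
  "tv_dist \<mu> \<nu> = (SUP A\<in>sets \<mu>. \<bar>measure \<mu> A - measure \<nu> A\<bar>)"

definition tv_continuous :: "(real \<Rightarrow> 'b measure) \<Rightarrow> bool" where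
  "tv_continuous q \<longleftrightarrow> (\<forall>r0. ((\<lambda>r. tv_dist (q r) (q r0)) \<longlongrightarrow> 0) (at r0))"

end

theory Submission
  imports Defs
begin

text \<open>Thinning multiplies the second factorial moment density of \<open>Z\<close> by \<open>w y\<^sub>0 * w y\<^sub>1\<close>, because the
  marks of two distinct points are independent and independent of the configuration. The two-point
  determinant of the kernel depends on \<open>x\<^sub>0, x\<^sub>1\<close> only through \<open>r = x\<^sub>1 - x\<^sub>0\<close>, so Fubini's theorem and
  a shear give the disintegration. On heights bounded below by \<open>\<alpha>\<close>, this determinant is Lipschitz in
  \<open>r\<^sup>2\<close> uniformly in the heights, which yields continuity in total variation. The kernel is unique
  because its product with the positive continuous function \<open>rho2 w\<close> is determined almost everywhere,
  hence everywhere, when tested against bounded continuous functions of the heights.\<close>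

section \<open>Sums over pairs of distinct points\<close>

text \<open>The integral \<open>nn_integral\<close> is additive only on measurable functions,
  whereas \<open>point_process_on\<close> makes counts of Borel sets measurable and says nothing of
  sums over pairs. The enumeration contained in \<open>independent_thinning\<close> closes this gap,
  for \<open>Z\<close> as well as for the thinned set: it turns a sum over a random set into a sum
  over fixed index pairs with measurable terms. A second obstacle is that \<open>w\<close> is given
  only on (0, \<infinity>) and \<open>H\<close> only over positive heights; both are extended by
  zero. The weights are then absorbed into a finite product measure under which both heights are at
  least \<alpha> almost everywhere, away from the singularity of the kernel at the boundary.
  Finally, r^2 + (y0 + y1)^2 exceeds 4 y0 y1 by r^2 + (y0 - y1)^2, so the two-point determinant is
  nonnegative and can vanish only for y0 = y1, a null set. This makes \<open>rho2 w\<close> strictly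
  positive, which normalisation, continuity and uniqueness all rely on.\<close>

lemma lborel_complex: "distr (lborel \<Otimes>\<^sub>M lborel) borel (\<lambda>(x, y). Complex x y) = lborel"
proof (rule lborel_eqI[symmetric])
  have [measurable]: "(\<lambda>(x, y). Complex x y) \<in> lborel \<Otimes>\<^sub>M lborel \<rightarrow>\<^sub>M borel"
    unfolding Complex_eq case_prod_beta by measurable
  fix l u :: complex
  assume lu: "\<And>b. b \<in> Basis \<Longrightarrow> l \<bullet> b \<le> u \<bullet> b"
  have *: "Re l \<le> Re u" "Im l \<le> Im u"
    using lu[of 1] lu[of \<i>] by (auto simp: Basis_complex_def)
  have "(\<lambda>(x, y). Complex x y) -` box l u = {Re l<..<Re u} \<times> {Im l<..<Im u}"
    by (auto simp: box_def Basis_complex_def)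
  then show "emeasure (distr (lborel \<Otimes>\<^sub>M lborel) borel (\<lambda>(x, y). Complex x y)) (box l u) =
      (\<Prod>b\<in>Basis. (u - l) \<bullet> b)"
    using * by (subst emeasure_distr)
      (auto simp: space_pair_measure Basis_complex_def lborel.emeasure_pair_measure_Times
        ennreal_mult[symmetric])
qed simp

lemma nn_integral_lborel_complex:
  fixes f :: "complex \<Rightarrow> ennreal"
  assumes [measurable]: "f \<in> borel_measurable borel"
  shows "(\<integral>\<^sup>+ z. f z \<partial>lborel) = (\<integral>\<^sup>+ x. \<integral>\<^sup>+ y. f (Complex x y) \<partial>lborel \<partial>lborel)"
proof -
  have [measurable]: "(\<lambda>(x, y). Complex x y) \<in> lborel \<Otimes>\<^sub>M lborel \<rightarrow>\<^sub>M borel"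
    unfolding Complex_eq case_prod_beta by measurable
  show ?thesis
    by (subst lborel_complex[symmetric], subst nn_integral_distr)
      (simp_all add: lborel.nn_integral_fst[symmetric] split_beta)
qed

lemma nn_integral_PiM_two:
  fixes f :: "'a \<times> 'a \<Rightarrow> ennreal"
  assumes "sigma_finite_measure M" and f [measurable]: "f \<in> borel_measurable (M \<Otimes>\<^sub>M M)"
  shows "(\<integral>\<^sup>+ z. f (z 0, z 1) \<partial>PiM {..<2::nat} (\<lambda>_. M)) = (\<integral>\<^sup>+ x. \<integral>\<^sup>+ y. f (x, y) \<partial>M \<partial>M)"
proof -
  interpret M: sigma_finite_measure M by fact
  interpret product_sigma_finite "\<lambda>_::nat. M" by standard
  \<comment> \<open>Putting 1 in front makes \<open>product_nn_integral_insert\<close> integrate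
    coordinate 1 innermost, which is the order of the claim.\<close>
  have *: "{..<2::nat} = insert 1 {0}" by auto
  have [measurable]: "(\<lambda>z. f (z 0, z 1)) \<in> borel_measurable (PiM (insert (1::nat) {0}) (\<lambda>_. M))"
    by measurable
  show ?thesis
    unfolding * by (subst product_nn_integral_insert)
      (auto intro!: trans[OF product_nn_integral_singleton])
qed

text \<open>Polymorphic because it serves both for points of the plane and for the indices that
  enumerate them.\<close>

definition distinct_pairs :: "'a set \<Rightarrow> ('a \<times> 'a) set" where
  "distinct_pairs S = {(x, y). x \<in> S \<and> y \<in> S \<and> x \<noteq> y}"

text \<open>Injectivity puts pairs of distinct indices in bijection with pairs of distinct points.
  The domain of summation no longer depends on \<open>I\<close>, which makes the sum ready to be
  exchanged with an expectation.\<close>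

lemma nn_integral_distinct_pairs_image:
  assumes "inj_on h I"
  shows "(\<integral>\<^sup>+ z. f z \<partial>count_space (distinct_pairs (h ` I))) =
    (\<integral>\<^sup>+ (m, n). f (h m, h n) * indicator (distinct_pairs I) (m, n) \<partial>count_space UNIV)"
proof -
  have "bij_betw (map_prod h h) (distinct_pairs I) (distinct_pairs (h ` I))"
    using assms by (auto simp: bij_betw_def distinct_pairs_def inj_on_def image_def)
  from nn_integral_bij_count_space[OF this, of f, symmetric] show ?thesis
    by (auto simp: nn_integral_count_space_indicator split_beta map_prod_def intro!: nn_integral_cong)
qed

text \<open>Factorial moments are defined through extensional functions on \<open>{..<k}\<close>,
  the target sums through ordered pairs; evaluation at 0 and 1 is the bijection between the two
  encodings for k = 2.\<close>

lemma emeasure_distinct_tuples_two: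
  "emeasure (count_space UNIV) (distinct_tuples 2 S \<inter> {z. (z 0, z 1) \<in> B}) =
    (\<integral>\<^sup>+ z. indicator B z \<partial>count_space (distinct_pairs S))"
proof -
  have "bij_betw (\<lambda>z. (z 0, z 1)) (distinct_tuples 2 S \<inter> {z. (z 0, z 1) \<in> B}) (distinct_pairs S \<inter> B)"
  proof (rule bij_betwI')
    fix x y assume *: "x \<in> distinct_tuples 2 S \<inter> {z. (z 0, z 1) \<in> B}"
      "y \<in> distinct_tuples 2 S \<inter> {z. (z 0, z 1) \<in> B}"
    show "((x 0, x 1) = (y 0, y 1)) = (x = y)"
    proof
      assume "(x 0, x 1) = (y 0, y 1)"
      then have "\<And>i. i \<in> {..<2} \<Longrightarrow> x i = y i" by (auto simp: less_2_cases_iff)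
      then show "x = y"
        using * by (intro PiE_ext[of x "{..<2}" "\<lambda>_. S" y]) (auto simp: distinct_tuples_def)
    qed auto
  next
    fix x assume "x \<in> distinct_tuples 2 S \<inter> {z. (z 0, z 1) \<in> B}"
    then show "(x 0, x 1) \<in> distinct_pairs S \<inter> B"
      using inj_onD[of x "{..<2}" 0 1] by (auto simp: distinct_tuples_def distinct_pairs_def PiE_def)
  next
    fix y assume y: "y \<in> distinct_pairs S \<inter> B"
    define x where "x = (\<lambda>i\<in>{..<2::nat}. if i = 0 then fst y else snd y)"
    have "x \<in> distinct_tuples 2 S \<inter> {z. (z 0, z 1) \<in> B} \<and> y = (x 0, x 1)"
      using y by (auto simp: x_def distinct_tuples_def distinct_pairs_def inj_on_def less_2_cases_iff)
    then show "\<exists>x\<in>distinct_tuples 2 S \<inter> {z. (z 0, z 1) \<in> B}. y = (x 0, x 1)" by blast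
  qed
  from nn_integral_bij_count_space[OF this, of "\<lambda>_. 1"] 
  have "emeasure (count_space UNIV) (distinct_tuples 2 S \<inter> {z. (z 0, z 1) \<in> B}) =
      (\<integral>\<^sup>+ z. 1 \<partial>count_space (distinct_pairs S \<inter> B))"
    by (simp add: emeasure_count_space)
  also have "\<dots> = (\<integral>\<^sup>+ z. indicator (distinct_pairs S \<inter> B) z \<partial>count_space UNIV)"
    by (simp add: emeasure_count_space)
  also have "\<dots> = (\<integral>\<^sup>+ z. indicator B z \<partial>count_space (distinct_pairs S))"
    unfolding indicator_inter_arith by (simp add: nn_integral_count_space_indicator mult.commute)
  finally show ?thesis .
qed

text \<open>Independence of generated sigma-algebras is the product rule on rectangles, and
  rectangles determine the product measure. This form lets the two variables have different value
  types, as \<open>(N, X)\<close> and \<open>U\<close> do.\<close>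

lemma (in prob_space) distr_pair_indep_set:
  assumes f [measurable]: "f \<in> M \<rightarrow>\<^sub>M S" and g [measurable]: "g \<in> M \<rightarrow>\<^sub>M T"
    and indep: "indep_set (sets (vimage_algebra (space M) f S)) (sets (vimage_algebra (space M) g T))"
  shows "distr M S f \<Otimes>\<^sub>M distr M T g = distr M (S \<Otimes>\<^sub>M T) (\<lambda>\<omega>. (f \<omega>, g \<omega>))"
proof (rule pair_measure_eqI)
  interpret f: prob_space "distr M S f" by (rule prob_space_distr) fact
  interpret g: prob_space "distr M T g" by (rule prob_space_distr) fact
  show "sigma_finite_measure (distr M S f)" "sigma_finite_measure (distr M T g)" by standard
  fix A B assume A: "A \<in> sets (distr M S f)" and B: "B \<in> sets (distr M T g)"
  have "prob ((f -` A \<inter> space M) \<inter> (g -` B \<inter> space M)) = prob (f -` A \<inter> space M) * prob (g -` B \<inter> space M)"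
    using A B by (intro indep_setD[OF indep] in_vimage_algebra) auto
  moreover have "(\<lambda>\<omega>. (f \<omega>, g \<omega>)) -` (A \<times> B) \<inter> space M = (f -` A \<inter> space M) \<inter> (g -` B \<inter> space M)"
    by auto
  ultimately show "emeasure (distr M S f) A * emeasure (distr M T g) B =
      emeasure (distr M (S \<Otimes>\<^sub>M T) (\<lambda>\<omega>. (f \<omega>, g \<omega>))) (A \<times> B)"
    using A B by (simp add: emeasure_distr emeasure_eq_measure ennreal_mult)
qed simp

text \<open>After reindexing, the sum runs over countably many fixed pairs (m, n), so measurability
  is checked term by term and sum and expectation can be exchanged. \<open>I\<close> is a random
  index set so that the same lemma covers the full configuration and the retained points.\<close>

lemma nn_integral_distinct_pairs_random:
  fixes X :: "nat \<Rightarrow> 'a \<Rightarrow> 'b::second_countable_topology" and f :: "'b \<times> 'b \<Rightarrow> ennreal"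
  assumes X [measurable]: "\<And>n. X n \<in> P \<rightarrow>\<^sub>M borel" and I [measurable]: "\<And>n. Measurable.pred P (\<lambda>\<omega>. n \<in> I \<omega>)"
    and f [measurable]: "f \<in> borel_measurable (borel \<Otimes>\<^sub>M borel)"
    and inj: "\<And>\<omega>. \<omega> \<in> space P \<Longrightarrow> inj_on (\<lambda>n. X n \<omega>) (I \<omega>)"
    and S: "\<And>\<omega>. \<omega> \<in> space P \<Longrightarrow> S \<omega> = (\<lambda>n. X n \<omega>) ` I \<omega>"
  shows borel_measurable_nn_integral_distinct_pairs:
      "(\<lambda>\<omega>. \<integral>\<^sup>+ z. f z \<partial>count_space (distinct_pairs (S \<omega>))) \<in> borel_measurable P"
    and nn_integral_nn_integral_distinct_pairs:
      "(\<integral>\<^sup>+ \<omega>. \<integral>\<^sup>+ z. f z \<partial>count_space (distinct_pairs (S \<omega>)) \<partial>P) =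
       (\<integral>\<^sup>+ (m, n). \<integral>\<^sup>+ \<omega>. f (X m \<omega>, X n \<omega>) * indicator (distinct_pairs (I \<omega>)) (m, n) \<partial>P
          \<partial>count_space UNIV)"
proof -
  have eq: "(\<integral>\<^sup>+ z. f z \<partial>count_space (distinct_pairs (S \<omega>))) = 
      (\<integral>\<^sup>+ mn. f (X (fst mn) \<omega>, X (snd mn) \<omega>) * indicator (distinct_pairs (I \<omega>)) mn \<partial>count_space UNIV)"
    if "\<omega> \<in> space P" for \<omega>
    using nn_integral_distinct_pairs_image[OF inj[OF that], of f] by (simp add: S[OF that] case_prod_unfold)
  have meas [measurable]: "(\<lambda>\<omega>. f (X (fst mn) \<omega>, X (snd mn) \<omega>) * indicator (distinct_pairs (I \<omega>)) mn)
      \<in> borel_measurable P" for mn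
  proof -
    have "(\<lambda>\<omega>. indicator (distinct_pairs (I \<omega>)) mn :: ennreal) =
        (\<lambda>\<omega>. if fst mn \<in> I \<omega> \<and> snd mn \<in> I \<omega> \<and> fst mn \<noteq> snd mn then 1 else 0)"
      by (auto simp: distinct_pairs_def fun_eq_iff split: split_indicator)
    then have [measurable]: "(\<lambda>\<omega>. indicator (distinct_pairs (I \<omega>)) mn :: ennreal) \<in> borel_measurable P"
      by simp
    show ?thesis by measurable
  qed
  \<comment> \<open>With a countable discrete factor, joint measurability reduces to that of each
    section. The factors are swapped afterwards because the index pair is the variable to be
    integrated out.\<close>
  have "(\<lambda>(mn, \<omega>). f (X (fst mn) \<omega>, X (snd mn) \<omega>) * indicator (distinct_pairs (I \<omega>)) mn)
      \<in> borel_measurable (count_space UNIV \<Otimes>\<^sub>M P)"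
    by (rule measurable_pair_measure_countable1) (auto simp: meas)
  from measurable_compose[OF measurable_pair_swap' this]
  have "(\<lambda>(\<omega>, mn). f (X (fst mn) \<omega>, X (snd mn) \<omega>) * indicator (distinct_pairs (I \<omega>)) mn)
      \<in> borel_measurable (P \<Otimes>\<^sub>M count_space UNIV)"
    by (simp add: case_prod_unfold)
  from sigma_finite_measure.borel_measurable_nn_integral_fst[OF sigma_finite_measure_count_space this]
  have "(\<lambda>\<omega>. \<integral>\<^sup>+ mn. f (X (fst mn) \<omega>, X (snd mn) \<omega>) * indicator (distinct_pairs (I \<omega>)) mn \<partial>count_space UNIV)
    \<in> borel_measurable P" by simp
  then show "(\<lambda>\<omega>. \<integral>\<^sup>+ z. f z \<partial>count_space (distinct_pairs (S \<omega>))) \<in> borel_measurable P"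
    by (subst measurable_cong[OF eq])
  show "(\<integral>\<^sup>+ \<omega>. \<integral>\<^sup>+ z. f z \<partial>count_space (distinct_pairs (S \<omega>)) \<partial>P) =
       (\<integral>\<^sup>+ (m, n). \<integral>\<^sup>+ \<omega>. f (X m \<omega>, X n \<omega>) * indicator (distinct_pairs (I \<omega>)) (m, n) \<partial>P
          \<partial>count_space UNIV)"
    by (simp add: eq nn_integral_count_space_nn_integral case_prod_unfold cong: nn_integral_cong)
qed

section \<open>Independent thinning\<close>

lemma emeasure_uniform_atMost:
  fixes a :: real
  assumes "0 \<le> a" "a \<le> 1"
  shows "emeasure (uniform_measure lborel {0..1}) {..a} = ennreal a"
proof -
  have "{0..1} \<inter> {..a} = {0..a}" using assms by auto
  then show ?thesis using assms by (simp add: divide_ennreal_def)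
qed

text \<open>The thinning is governed by \<open>p'\<close>, which has to agree with the globally
  measurable \<open>p\<close> only at the points of \<open>Z\<close>: the retention probability
  \<open>w (Im z)\<close> carries no measurability off the half-plane.\<close>

lemma (in prob_space) nn_integral_distinct_pairs_thinning:
  fixes f :: "complex \<times> complex \<Rightarrow> ennreal"
  assumes thin: "independent_thinning M Z p' T" and p_eq: "\<And>\<omega> z. \<omega> \<in> space M \<Longrightarrow> z \<in> Z \<omega> \<Longrightarrow> p' z = p z"
    and f [measurable]: "f \<in> borel_measurable (borel \<Otimes>\<^sub>M borel)" and p [measurable]: "p \<in> borel_measurable borel"
    and p01: "\<And>z. 0 \<le> p z" "\<And>z. p z \<le> 1"
  shows "(\<integral>\<^sup>+ \<omega>. \<integral>\<^sup>+ z. f z \<partial>count_space (distinct_pairs (T \<omega>)) \<partial>M) =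
    (\<integral>\<^sup>+ \<omega>. \<integral>\<^sup>+ z. f z * ennreal (p (fst z) * p (snd z)) \<partial>count_space (distinct_pairs (Z \<omega>)) \<partial>M)"
proof -
  obtain N :: "'a \<Rightarrow> enat" and X :: "nat \<Rightarrow> 'a \<Rightarrow> complex" and U :: "nat \<Rightarrow> 'a \<Rightarrow> real" where
    enum: "\<forall>\<omega>\<in>space M. inj_on (\<lambda>n. X n \<omega>) {n. enat n < N \<omega>} \<and> Z \<omega> = {X n \<omega> | n. enat n < N \<omega>}" and
    U_indep: "indep_vars (\<lambda>_. borel) U UNIV" and
    U_unif: "\<forall>n. distr M borel (U n) = uniform_measure lborel {0..1}" and
    N [measurable]: "N \<in> M \<rightarrow>\<^sub>M count_space UNIV" and X': "\<forall>n. X n \<in> M \<rightarrow>\<^sub>M borel" and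
    indep: "indep_set
          (sets (vimage_algebra (space M) (\<lambda>\<omega>. (N \<omega>, \<lambda>n. X n \<omega>))
             (count_space UNIV \<Otimes>\<^sub>M PiM UNIV (\<lambda>_. borel))))
          (sets (vimage_algebra (space M) (\<lambda>\<omega> n. U n \<omega>) (PiM UNIV (\<lambda>_. borel))))" and
    T': "\<forall>\<omega>\<in>space M. T \<omega> = {X n \<omega> | n. enat n < N \<omega> \<and> U n \<omega> \<le> p' (X n \<omega>)}"
    using thin unfolding independent_thinning_def by (elim exE conjE) (rule that)
  have inj: "inj_on (\<lambda>n. X n \<omega>) {n. enat n < N \<omega>}" and Z: "Z \<omega> = {X n \<omega> | n. enat n < N \<omega>}"
    if "\<omega> \<in> space M" for \<omega> using enum that by auto
  have X [measurable]: "X n \<in> M \<rightarrow>\<^sub>M borel" for n using X' by blast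
  have T: "T \<omega> = {X n \<omega> | n. enat n < N \<omega> \<and> U n \<omega> \<le> p (X n \<omega>)}" if "\<omega> \<in> space M" for \<omega>
  proof -
    have "p' (X n \<omega>) = p (X n \<omega>)" if "enat n < N \<omega>" for n
      using \<open>\<omega> \<in> space M\<close> that by (intro p_eq) (auto simp: Z)
    then show ?thesis unfolding T'[rule_format, OF that] by (intro Collect_cong ex_cong1) auto
  qed
  have U [measurable]: "U n \<in> borel_measurable M" for n
    using U_indep unfolding indep_vars_def by auto
  let ?S = "count_space UNIV \<Otimes>\<^sub>M PiM UNIV (\<lambda>_. borel) :: (enat \<times> (nat \<Rightarrow> complex)) measure"
  let ?T = "PiM UNIV (\<lambda>_. borel) :: (nat \<Rightarrow> real) measure"
  let ?V = "\<lambda>\<omega>. (N \<omega>, \<lambda>n. X n \<omega>)" and ?U = "\<lambda>\<omega> n. U n \<omega>"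
  have V [measurable]: "?V \<in> M \<rightarrow>\<^sub>M ?S" and W [measurable]: "?U \<in> M \<rightarrow>\<^sub>M ?T"
    by (auto intro!: measurable_Pair measurable_PiM_single')
  note joint = distr_pair_indep_set[OF V W indep]
  interpret W: prob_space "distr M ?T ?U" by (rule prob_space_distr) fact

  \<comment> \<open>The thresholds a and b are constants here; they become the retention
    probabilities of two points once the configuration is frozen.\<close>
  have marks: "(\<integral>\<^sup>+ \<omega>. indicator {..a} (U m \<omega>) * indicator {..b} (U n \<omega>) \<partial>M) = ennreal (a * b)"
    if "m \<noteq> n" and ab: "0 \<le> a" "a \<le> 1" "0 \<le> b" "b \<le> 1" for m n a b
  proof -
    have unif: "prob (U k -` {..c} \<inter> space M) = c" if "0 \<le> c" "c \<le> 1" for k c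
    proof -
      have "emeasure M (U k -` {..c} \<inter> space M) = ennreal c"
        using emeasure_uniform_atMost[OF that] by (simp add: emeasure_distr flip: U_unif[rule_format, of k])
      then show ?thesis using that by (simp add: emeasure_eq_measure)
    qed
    have "prob (\<Inter>i\<in>{m, n}. U i -` (if i = m then {..a} else {..b}) \<inter> space M) =
        (\<Prod>i\<in>{m, n}. prob (U i -` (if i = m then {..a} else {..b}) \<inter> space M))"
      by (rule indep_varsD[OF U_indep]) auto
    then have "prob ((U m -` {..a} \<inter> space M) \<inter> (U n -` {..b} \<inter> space M)) = a * b"
      using \<open>m \<noteq> n\<close> unif ab by simp
    moreover have "(\<integral>\<^sup>+ \<omega>. indicator {..a} (U m \<omega>) * indicator {..b} (U n \<omega>) \<partial>M) =
      (\<integral>\<^sup>+ \<omega>. indicator ((U m -` {..a} \<inter> space M) \<inter> (U n -` {..b} \<inter> space M)) \<omega> \<partial>M)"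
      by (intro nn_integral_cong) (auto split: split_indicator)
    ultimately show ?thesis by (simp add: emeasure_eq_measure)
  qed

  let ?I = "\<lambda>\<omega>. {n. enat n < N \<omega>}" and ?J = "\<lambda>\<omega>. {n. enat n < N \<omega> \<and> U n \<omega> \<le> p (X n \<omega>)}"
  have pair: "(\<integral>\<^sup>+ \<omega>. f (X m \<omega>, X n \<omega>) * indicator (distinct_pairs (?J \<omega>)) (m, n) \<partial>M) =
     (\<integral>\<^sup>+ \<omega>. (f (X m \<omega>, X n \<omega>) * ennreal (p (X m \<omega>) * p (X n \<omega>))) *
        indicator (distinct_pairs (?I \<omega>)) (m, n) \<partial>M)" for m n
  \<comment> \<open>On the diagonal both indicators of \<open>distinct_pairs\<close> vanish. Off it
    two different marks are involved, so \<open>marks\<close> applies.\<close>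
  proof (cases "m = n")
    case False
    \<comment> \<open>\<open>g\<close> collects what depends on the configuration alone, including
      whether both indices occur; \<open>F\<close> adds the retention events, so that for fixed
      \<open>v\<close> only the marks remain random.\<close>
    define g where "g v = (if enat m < fst v \<and> enat n < fst v then f (snd v m, snd v n) else 0)"
      for v :: "enat \<times> (nat \<Rightarrow> complex)"
    have [measurable]: "g \<in> borel_measurable ?S"
      unfolding g_def by measurable
    define F where "F = (\<lambda>(v :: enat \<times> (nat \<Rightarrow> complex), u :: nat \<Rightarrow> real).
      g v * (indicator {..p (snd v m)} (u m) * indicator {..p (snd v n)} (u n)))"
    have F [measurable]: "F \<in> borel_measurable (?S \<Otimes>\<^sub>M ?T)"
    proof -
      have "F = (\<lambda>vu. g (fst vu) * ((if snd vu m \<le> p (snd (fst vu) m) then 1 else 0) *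
          (if snd vu n \<le> p (snd (fst vu) n) then 1 else 0)))"
        by (auto simp: F_def fun_eq_iff split: split_indicator)
      then show ?thesis by simp
    qed
    have inner: "(\<integral>\<^sup>+ u. F (v, u) \<partial>distr M ?T ?U) = (\<integral>\<^sup>+ \<omega>. F (v, ?U \<omega>) \<partial>M)" for v
    proof -
      have "v \<in> space ?S" by (simp add: space_pair_measure space_PiM mem_Times_iff)
      from measurable_compose[OF measurable_Pair1'[OF this] F]
      show ?thesis by (simp add: nn_integral_distr)
    qed
    have "(\<integral>\<^sup>+ \<omega>. f (X m \<omega>, X n \<omega>) * indicator (distinct_pairs (?J \<omega>)) (m, n) \<partial>M) =
        (\<integral>\<^sup>+ \<omega>. F (?V \<omega>, ?U \<omega>) \<partial>M)"
      using False by (intro nn_integral_cong) (auto simp: F_def g_def distinct_pairs_def split: split_indicator)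
    also have "\<dots> = (\<integral>\<^sup>+ x. F x \<partial>(distr M ?S ?V \<Otimes>\<^sub>M distr M ?T ?U))"
      unfolding joint by (subst nn_integral_distr) auto
    \<comment> \<open>The joint law is a product, so configuration and marks may be read from two
      separate copies \<omega> and \<omega>' of the probability space; the inner integral over
      \<omega>' is then given by \<open>marks\<close>.\<close>
    also have "\<dots> = (\<integral>\<^sup>+ \<omega>. \<integral>\<^sup>+ \<omega>'. F (?V \<omega>, ?U \<omega>') \<partial>M \<partial>M)"
      by (subst W.nn_integral_fst[symmetric]) (simp_all add: nn_integral_distr[of _ M ?S] inner)
    also have "\<dots> = (\<integral>\<^sup>+ \<omega>. g (?V \<omega>) * ennreal (p (X m \<omega>) * p (X n \<omega>)) \<partial>M)"
      using False by (simp add: F_def nn_integral_cmult marks p01)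
    also have "\<dots> = (\<integral>\<^sup>+ \<omega>. (f (X m \<omega>, X n \<omega>) * ennreal (p (X m \<omega>) * p (X n \<omega>))) *
        indicator (distinct_pairs (?I \<omega>)) (m, n) \<partial>M)"
      using False by (intro nn_integral_cong) (auto simp: g_def distinct_pairs_def split: split_indicator)
    finally show ?thesis .
  qed (simp add: distinct_pairs_def)
  have "(\<integral>\<^sup>+ \<omega>. \<integral>\<^sup>+ z. f z \<partial>count_space (distinct_pairs (T \<omega>)) \<partial>M) =
      (\<integral>\<^sup>+ (m, n). \<integral>\<^sup>+ \<omega>. f (X m \<omega>, X n \<omega>) * indicator (distinct_pairs (?J \<omega>)) (m, n) \<partial>M
          \<partial>count_space UNIV)"
    by (rule nn_integral_nn_integral_distinct_pairs) (auto simp: T intro: inj_on_subset[OF inj])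
  also have "\<dots> = (\<integral>\<^sup>+ (m, n). \<integral>\<^sup>+ \<omega>. (f (X m \<omega>, X n \<omega>) * ennreal (p (X m \<omega>) * p (X n \<omega>))) *
        indicator (distinct_pairs (?I \<omega>)) (m, n) \<partial>M \<partial>count_space UNIV)"
    by (simp add: pair)
  also have "\<dots> = (\<integral>\<^sup>+ \<omega>. \<integral>\<^sup>+ z. f z * ennreal (p (fst z) * p (snd z)) \<partial>count_space (distinct_pairs (Z \<omega>)) \<partial>M)"
    by (subst nn_integral_nn_integral_distinct_pairs[where I = ?I and X = X]) (auto simp: Z inj)
  finally show ?thesis .
qed

section \<open>Pair sums of a determinantal process\<close>

lemma det_mat_two:
  fixes f :: "nat \<times> nat \<Rightarrow> 'a::comm_ring_1"
  shows "Determinant.det (Matrix.mat 2 2 f) = f (0, 0) * f (1, 1) - f (0, 1) * f (1, 0)"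
  using laplace_expansion_column[of "Matrix.mat 2 2 f" 2 0]
  by (simp add: cofactor_def mat_delete_def det_single numeral_2_eq_2)

text \<open>The definition speaks of sets of tuples only, so the identity is obtained for indicators
  and extended by induction on nonnegative measurable functions. The enumeration by \<open>X\<close>
  and \<open>I\<close> supplies the measurability in \<omega> that additivity and monotone
  convergence over \<open>P\<close> require.\<close>

lemma nn_integral_distinct_pairs_determinantal:
  fixes f :: "complex \<times> complex \<Rightarrow> ennreal"
  assumes det: "determinantal_process P D K Z" and D [measurable]: "D \<in> sets borel"
    and K: "(\<lambda>(z, \<zeta>). Re (K z z * K \<zeta> \<zeta> - K z \<zeta> * K \<zeta> z)) \<in> borel_measurable (borel \<Otimes>\<^sub>M borel)"
    and X [measurable]: "\<And>n. X n \<in> P \<rightarrow>\<^sub>M borel" and I [measurable]: "\<And>n. Measurable.pred P (\<lambda>\<omega>. (n::nat) \<in> I \<omega>)"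
    and inj: "\<And>\<omega>. \<omega> \<in> space P \<Longrightarrow> inj_on (\<lambda>n. X n \<omega>) (I \<omega>)"
    and Z: "\<And>\<omega>. \<omega> \<in> space P \<Longrightarrow> Z \<omega> = (\<lambda>n. X n \<omega>) ` I \<omega>"
    and f: "f \<in> borel_measurable (borel \<Otimes>\<^sub>M borel)"
  shows "(\<integral>\<^sup>+ \<omega>. \<integral>\<^sup>+ z. f z \<partial>count_space (distinct_pairs (Z \<omega>)) \<partial>P) =
    (\<integral>\<^sup>+ z\<in>D. \<integral>\<^sup>+ \<zeta>\<in>D. f (z, \<zeta>) * ennreal (Re (K z z * K \<zeta> \<zeta> - K z \<zeta> * K \<zeta> z)) \<partial>lborel \<partial>lborel)"
proof -
  note meas = borel_measurable_nn_integral_distinct_pairs[OF X I _ inj Z]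
  define L where "L = restrict_space (lborel :: complex measure) D"
  define h where "h = (\<lambda>(z, \<zeta>). ennreal (Re (K z z * K \<zeta> \<zeta> - K z \<zeta> * K \<zeta> z)))"
  have L: "sigma_finite_measure L"
    unfolding L_def by (intro sigma_finite_measure_restrict_space) (auto intro: lborel.sigma_finite_measure_axioms)
  have [measurable]: "h \<in> borel_measurable (borel \<Otimes>\<^sub>M borel)"
    using K unfolding h_def split_beta by measurable
  \<comment> \<open>The induction runs over functions measurable for the plain Borel product, but
    they are integrated over the restricted measure \<open>L\<close>.\<close>
  have L_meas: "u \<in> borel_measurable (L \<Otimes>\<^sub>M L)" if "u \<in> borel_measurable (borel \<Otimes>\<^sub>M borel)"
    for u :: "complex \<times> complex \<Rightarrow> ennreal"
  proof -
    have "(\<lambda>z. z) \<in> L \<rightarrow>\<^sub>M borel" unfolding L_def by (auto intro: measurable_restrict_space1)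
    then have "(\<lambda>z. (fst z, snd z)) \<in> L \<Otimes>\<^sub>M L \<rightarrow>\<^sub>M borel \<Otimes>\<^sub>M borel" by measurable
    from measurable_compose[OF this that] show ?thesis by simp
  qed
  interpret L: sigma_finite_measure L by fact
  from f have "(\<integral>\<^sup>+ \<omega>. \<integral>\<^sup>+ z. f z \<partial>count_space (distinct_pairs (Z \<omega>)) \<partial>P) =
    (\<integral>\<^sup>+ z. f z * h z \<partial>(L \<Otimes>\<^sub>M L))"
  proof induction
    case (cong f g)
    then show ?case by (simp add: fun_eq_iff[symmetric] space_pair_measure)
  next
    case (set A)
    \<comment> \<open>The set is cut down to the space of the product measure so as to be measurable
      there. Since \<open>Z \<omega> \<subseteq> D\<close>, no tuple of points of the process is
      lost.\<close>
    let ?B = "{z \<in> space (PiM {..<2::nat} (\<lambda>_. L)). (z 0, z 1) \<in> A}"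
    have L': "(\<lambda>z. z) \<in> L \<rightarrow>\<^sub>M borel" unfolding L_def by (auto intro: measurable_restrict_space1)
    have "(\<lambda>z. (z 0, z 1)) \<in> PiM {..<2::nat} (\<lambda>_. L) \<rightarrow>\<^sub>M borel \<Otimes>\<^sub>M borel"
      by (intro measurable_Pair measurable_compose[OF measurable_component_singleton[where M="\<lambda>_. L"] L']) auto
    from measurable_sets[OF this set] have B: "?B \<in> sets (PiM {..<2::nat} (\<lambda>_. L))"
      by (simp add: vimage_def Int_def conj_commute)
    have "(\<integral>\<^sup>+ \<omega>. \<integral>\<^sup>+ z. indicator A z \<partial>count_space (distinct_pairs (Z \<omega>)) \<partial>P) = factorial_moment P Z 2 ?B"
      unfolding factorial_moment_def
    proof (intro nn_integral_cong)
      fix \<omega> assume "\<omega> \<in> space P"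
      then have "Z \<omega> \<subseteq> D" using det by (auto simp: determinantal_process_def point_process_on_def)
      then have "distinct_tuples 2 (Z \<omega>) \<inter> ?B = distinct_tuples 2 (Z \<omega>) \<inter> {z. (z 0, z 1) \<in> A}"
        by (auto simp: distinct_tuples_def space_PiM L_def space_restrict_space PiE_iff)
      then show "(\<integral>\<^sup>+ z. indicator A z \<partial>count_space (distinct_pairs (Z \<omega>))) =
          emeasure (count_space UNIV) (distinct_tuples 2 (Z \<omega>) \<inter> ?B)"
        by (simp only: emeasure_distinct_tuples_two)
    qed
    also have "\<dots> = (\<integral>\<^sup>+ z\<in>?B. ennreal (Re (Determinant.det (Matrix.mat 2 2 (\<lambda>(i, j). K (z i) (z j))))) \<partial>PiM {..<2::nat} (\<lambda>_. L))"
      using det B unfolding determinantal_process_def L_def by auto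
    also have "\<dots> = (\<integral>\<^sup>+ z. indicator A (z 0, z 1) * h (z 0, z 1) \<partial>PiM {..<2::nat} (\<lambda>_. L))"
      by (intro nn_integral_cong) (auto simp: det_mat_two h_def split: split_indicator)
    also have "\<dots> = (\<integral>\<^sup>+ z. indicator A z * h z \<partial>(L \<Otimes>\<^sub>M L))"
      using set by (subst nn_integral_PiM_two[OF L, where f="\<lambda>z. indicator A z * h z"])
        (auto intro!: L_meas L.nn_integral_fst)
    finally show ?case .
  next
    case (mult u c)
    then show ?case
      by (simp add: nn_integral_cmult meas L_meas mult.assoc)
  next
    case (add u v)
    then show ?case
      by (simp add: nn_integral_add meas L_meas distrib_right)
  next
    case (seq U)
    have mono: "incseq (\<lambda>i. \<lambda>z. U i z * h z)"
      using seq(3) by (auto simp: incseq_def le_fun_def intro!: mult_right_mono)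
    have inc: "incseq (\<lambda>i. \<lambda>\<omega>. \<integral>\<^sup>+ z. U i z \<partial>count_space (distinct_pairs (Z \<omega>)))"
      using seq(3) by (auto simp: incseq_def le_fun_def intro!: nn_integral_mono)
    have "(\<integral>\<^sup>+ \<omega>. \<integral>\<^sup>+ z. (SUP i. U i) z \<partial>count_space (distinct_pairs (Z \<omega>)) \<partial>P) =
        (SUP i. \<integral>\<^sup>+ \<omega>. \<integral>\<^sup>+ z. U i z \<partial>count_space (distinct_pairs (Z \<omega>)) \<partial>P)"
      using seq by (simp add: image_comp nn_integral_monotone_convergence_SUP meas inc)
    also have "\<dots> = (SUP i. \<integral>\<^sup>+ z. U i z * h z \<partial>(L \<Otimes>\<^sub>M L))"
      using seq by simp
    also have "\<dots> = (\<integral>\<^sup>+ z. (SUP i. U i z * h z) \<partial>(L \<Otimes>\<^sub>M L))"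
      using seq by (subst nn_integral_monotone_convergence_SUP[OF mono]) (auto intro!: L_meas)
    also have "\<dots> = (\<integral>\<^sup>+ z. (SUP i. U i) z * h z \<partial>(L \<Otimes>\<^sub>M L))"
      by (simp add: image_comp SUP_mult_right_ennreal)
    finally show ?case by (simp add: image_comp)
  qed
  also have "\<dots> = (\<integral>\<^sup>+ z. \<integral>\<^sup>+ \<zeta>. f (z, \<zeta>) * h (z, \<zeta>) \<partial>L \<partial>L)"
    using f by (subst L.nn_integral_fst) (auto intro!: L_meas)
  also have "\<dots> = (\<integral>\<^sup>+ z\<in>D. \<integral>\<^sup>+ \<zeta>\<in>D. f (z, \<zeta>) * h (z, \<zeta>) \<partial>lborel \<partial>lborel)"
    by (simp add: L_def nn_integral_restrict_space)
  finally show ?thesis by (simp add: h_def)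
qed

section \<open>The height kernel\<close>

text \<open>The two-point determinant of \<open>K_H\<close> at heights y0, y1 and horizontal
  displacement r, as \<open>K_H_two_point\<close> shows; it is also the bracket in the density of
  \<open>Q\<close>.\<close>

definition kappa :: "real \<Rightarrow> real \<times> real \<Rightarrow> real" where
  "kappa r = (\<lambda>(y0, y1). 1 / (16 * pi\<^sup>2 * y0\<^sup>2 * y1\<^sup>2) - 1 / (pi\<^sup>2 * (r\<^sup>2 + (y0 + y1)\<^sup>2)\<^sup>2))"

lemma borel_measurable_fst_snd [measurable]:
  "fst \<in> (borel :: ('a::second_countable_topology \<times> 'b::second_countable_topology) measure) \<rightarrow>\<^sub>M borel"
  "snd \<in> (borel :: ('a \<times> 'b) measure) \<rightarrow>\<^sub>M borel"
  by (simp_all flip: borel_prod)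

lemma borel_measurable_kappa [measurable]:
  "(\<lambda>z. kappa (f z) (g z)) \<in> borel_measurable M" if [measurable]: "f \<in> borel_measurable M" "g \<in> M \<rightarrow>\<^sub>M borel"
  unfolding kappa_def split_beta by measurable

text \<open>AM-GM with its remainder: (y0 + y1)^2 = 4 y0 y1 + (y0 - y1)^2. Equality forces the
  remainder r^2 + (y0 - y1)^2 to vanish.\<close>

lemma sixteen_mult_le:
  fixes y0 y1 r :: real
  assumes "0 < y0" "0 < y1"
  shows "16 * y0\<^sup>2 * y1\<^sup>2 \<le> (r\<^sup>2 + (y0 + y1)\<^sup>2)\<^sup>2"
    and "16 * y0\<^sup>2 * y1\<^sup>2 = (r\<^sup>2 + (y0 + y1)\<^sup>2)\<^sup>2 \<Longrightarrow> y0 = y1"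
proof -
  have eq: "r\<^sup>2 + (y0 + y1)\<^sup>2 = 4 * y0 * y1 + (r\<^sup>2 + (y0 - y1)\<^sup>2)" 
    by (simp add: power2_eq_square algebra_simps)
  have sq: "16 * y0\<^sup>2 * y1\<^sup>2 = (4 * y0 * y1)\<^sup>2" by (simp add: power_mult_distrib)
  show "16 * y0\<^sup>2 * y1\<^sup>2 \<le> (r\<^sup>2 + (y0 + y1)\<^sup>2)\<^sup>2"
    unfolding sq eq using assms by (intro power_mono) auto
  assume "16 * y0\<^sup>2 * y1\<^sup>2 = (r\<^sup>2 + (y0 + y1)\<^sup>2)\<^sup>2"
  then have "4 * y0 * y1 = 4 * y0 * y1 + (r\<^sup>2 + (y0 - y1)\<^sup>2)"
    unfolding sq eq using assms by (subst (asm) power2_eq_iff_nonneg) auto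
  then show "y0 = y1" by (simp add: add_nonneg_eq_0_iff)
qed

lemma kappa_eq: "kappa r (y0, y1) = (1 / (16 * y0\<^sup>2 * y1\<^sup>2) - 1 / (r\<^sup>2 + (y0 + y1)\<^sup>2)\<^sup>2) / pi\<^sup>2"
  by (simp add: kappa_def diff_divide_distrib mult.assoc mult.commute[of _ "pi\<^sup>2"])

text \<open>Reciprocals in \<open>sixteen_mult_le\<close>. The sign matters because
  \<open>ennreal\<close> would silently cut off negative values in the density of
  \<open>Q\<close>.\<close>

lemma kappa_nonneg: "0 \<le> kappa r y" if "y \<in> quadrant"
proof -
  obtain y0 y1 where y: "y = (y0, y1)" "0 < y0" "0 < y1" using \<open>y \<in> quadrant\<close> by auto
  have "1 / (r\<^sup>2 + (y0 + y1)\<^sup>2)\<^sup>2 \<le> 1 / (16 * y0\<^sup>2 * y1\<^sup>2)"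
  proof (rule divide_left_mono)
    have "0 < 16 * y0\<^sup>2 * y1\<^sup>2" using y by simp
    then show "0 < (r\<^sup>2 + (y0 + y1)\<^sup>2)\<^sup>2 * (16 * y0\<^sup>2 * y1\<^sup>2)"
      using sixteen_mult_le(1)[OF y(2,3), of r] by (metis less_le_trans mult_pos_pos)
    show "16 * y0\<^sup>2 * y1\<^sup>2 \<le> (r\<^sup>2 + (y0 + y1)\<^sup>2)\<^sup>2" by (rule sixteen_mult_le(1)[OF y(2,3)])
  qed simp
  then show ?thesis unfolding y(1) kappa_eq by simp
qed

lemma kappa_eq_0D: "y0 = y1" if "kappa r (y0, y1) = 0" "0 < y0" "0 < y1"
proof -
  have "1 / (16 * y0\<^sup>2 * y1\<^sup>2) = 1 / (r\<^sup>2 + (y0 + y1)\<^sup>2)\<^sup>2"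
    using that(1) unfolding kappa_eq by simp
  then have "16 * y0\<^sup>2 * y1\<^sup>2 = (r\<^sup>2 + (y0 + y1)\<^sup>2)\<^sup>2"
    by (simp only: divide_cancel_left) simp
  from sixteen_mult_le(2)[OF that(2,3) this] show ?thesis .
qed

text \<open>Dropping the subtracted term leaves a bound uniform in r, in which the heights enter
  through their lower bound only.\<close>

lemma kappa_bound: "kappa r (y0, y1) \<le> 1 / (16 * pi\<^sup>2 * a ^ 4)" if "0 < a" "a \<le> y0" "a \<le> y1"
proof -
  have "a ^ 4 \<le> y0\<^sup>2 * y1\<^sup>2"
    using that mult_mono[OF power_mono[of a y0 2] power_mono[of a y1 2]] by (simp flip: power_add)
  then have "1 / (16 * pi\<^sup>2 * (y0\<^sup>2 * y1\<^sup>2)) \<le> 1 / (16 * pi\<^sup>2 * a ^ 4)"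
    using that by (intro divide_left_mono) auto
  moreover have "kappa r (y0, y1) \<le> 1 / (16 * pi\<^sup>2 * (y0\<^sup>2 * y1\<^sup>2))"
    by (simp add: kappa_def mult.assoc)
  ultimately show ?thesis by linarith
qed

text \<open>Factor the difference as (1/(a b^2) + 1/(a^2 b)) (b - a) and bound each summand by
  1/c^3. The constant 2/c^3 is the steepest slope of 1/t^2 on t \<ge> c.\<close>

lemma inverse_square_diff_bound:
  fixes a b c :: real
  assumes "0 < c" "c \<le> a" "c \<le> b"
  shows "\<bar>1 / a\<^sup>2 - 1 / b\<^sup>2\<bar> \<le> 2 / c ^ 3 * \<bar>a - b\<bar>"
proof -
  have ab: "0 < a" "0 < b" using assms by auto
  have "1 / a\<^sup>2 - 1 / b\<^sup>2 = (1 / (a * b\<^sup>2) + 1 / (a\<^sup>2 * b)) * (b - a)"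
    using ab by (simp add: field_simps power2_eq_square)
  moreover have "c ^ 3 \<le> a * b\<^sup>2" "c ^ 3 \<le> a\<^sup>2 * b"
  proof -
    have "c * c\<^sup>2 \<le> a * b\<^sup>2" "c\<^sup>2 * c \<le> a\<^sup>2 * b"
      using assms by (intro mult_mono power_mono; simp)+
    then show "c ^ 3 \<le> a * b\<^sup>2" "c ^ 3 \<le> a\<^sup>2 * b"
      by (simp_all add: power3_eq_cube power2_eq_square mult.assoc)
  qed
  then have "1 / (a * b\<^sup>2) \<le> 1 / c ^ 3" "1 / (a\<^sup>2 * b) \<le> 1 / c ^ 3"
    using assms ab by (auto intro!: divide_left_mono)
  moreover have "0 \<le> 1 / (a * b\<^sup>2)" "0 \<le> 1 / (a\<^sup>2 * b)" using ab by auto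
  ultimately show ?thesis
    using mult_right_mono[of "1 / (a * b\<^sup>2) + 1 / (a\<^sup>2 * b)" "2 / c ^ 3" "\<bar>b - a\<bar>"]
    by (simp only: abs_mult abs_minus_commute[of a b]) simp
qed

text \<open>The first term of \<open>kappa\<close> is free of r and cancels; the rest is
  \<open>inverse_square_diff_bound\<close> with c = a^2, a common lower bound for r^2 + (y0 + y1)^2
  and s^2 + (y0 + y1)^2.\<close>

lemma kappa_diff_bound:
  assumes "0 < a" "a \<le> y0" "a \<le> y1"
  shows "\<bar>kappa r (y0, y1) - kappa s (y0, y1)\<bar> \<le> 2 / (pi\<^sup>2 * (a\<^sup>2) ^ 3) * \<bar>r\<^sup>2 - s\<^sup>2\<bar>"
proof -
  have "a\<^sup>2 \<le> (y0 + y1)\<^sup>2" using assms by (intro power_mono) auto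
  then have *: "a\<^sup>2 \<le> r\<^sup>2 + (y0 + y1)\<^sup>2" "a\<^sup>2 \<le> s\<^sup>2 + (y0 + y1)\<^sup>2"
    by (auto intro: add_increasing)
  have "kappa r (y0, y1) - kappa s (y0, y1) =
      - (1 / pi\<^sup>2 * (1 / (r\<^sup>2 + (y0 + y1)\<^sup>2)\<^sup>2 - 1 / (s\<^sup>2 + (y0 + y1)\<^sup>2)\<^sup>2))"
    by (simp add: kappa_def right_diff_distrib)
  then have "\<bar>kappa r (y0, y1) - kappa s (y0, y1)\<bar> =
      1 / pi\<^sup>2 * \<bar>1 / (r\<^sup>2 + (y0 + y1)\<^sup>2)\<^sup>2 - 1 / (s\<^sup>2 + (y0 + y1)\<^sup>2)\<^sup>2\<bar>"
    by (simp only: abs_minus_cancel abs_mult) simp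
  also have "\<dots> \<le> 1 / pi\<^sup>2 * (2 / (a\<^sup>2) ^ 3 * \<bar>(r\<^sup>2 + (y0 + y1)\<^sup>2) - (s\<^sup>2 + (y0 + y1)\<^sup>2)\<bar>)"
    using assms * by (intro mult_left_mono inverse_square_diff_bound) auto
  finally show ?thesis by simp
qed

section \<open>Height integrals against the weights\<close>

locale height_weight =
  fixes a b :: real and w :: "real \<Rightarrow> real"
  assumes a_pos: "0 < a" and w: "w \<in> weights a b"
begin

text \<open>Extension by zero: \<open>weights\<close> prescribes nothing off (0, \<infinity>),
  whereas the integrals below run over the whole line.\<close>

definition W :: "real \<Rightarrow> real" where
  "W y = indicator {0<..} y * w y"

text \<open>A finite measure carried by \<open>{a..b}\<close>. Integrals with weight w(y0) w(y1)
  become integrals over the finite measure \<open>\<mu>\<close>, for which bounded measurable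
  functions are integrable.\<close>

definition \<nu> :: "real measure" where
  "\<nu> = density lborel (\<lambda>y. ennreal (W y))"

abbreviation \<mu> :: "(real \<times> real) measure" where
  "\<mu> \<equiv> \<nu> \<Otimes>\<^sub>M \<nu>"

lemma W_measurable [measurable]: "W \<in> borel_measurable borel"
  using w unfolding weights_def W_def[abs_def] by (auto simp: borel_measurable_restrict_space_iff)

lemma W_nonneg: "0 \<le> W y" and W_le_1: "W y \<le> 1" and W_eq_0: "y \<notin> {a..b} \<Longrightarrow> W y = 0"
  and W_eq: "0 < y \<Longrightarrow> W y = w y"
  using w a_pos by (auto simp: weights_def W_def split: split_indicator)

lemma sets_\<nu> [measurable_cong, simp]: "sets \<nu> = sets borel"
  by (simp add: \<nu>_def)

lemma space_\<nu> [simp]: "space \<nu> = UNIV"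
  by (simp add: \<nu>_def)

lemma sets_\<mu> [measurable_cong]: "sets \<mu> = sets (borel :: (real \<times> real) measure)"
  by (simp flip: borel_prod cong: sets_pair_measure_cong)

text \<open>Finite because \<open>W\<close> lies below the indicator of a bounded interval; nonzero
  because the integral of \<open>w\<close> over \<open>{a..b}\<close> is positive. The second fact
  is used for \<open>rho2_pos\<close>.\<close>

lemma emeasure_\<nu>: "emeasure \<nu> UNIV \<noteq> \<infinity>" "emeasure \<nu> UNIV \<noteq> 0"
proof -
  have eq: "emeasure \<nu> UNIV = (\<integral>\<^sup>+ y. ennreal (W y) \<partial>lborel)"
    by (simp add: \<nu>_def emeasure_density)
  also have "\<dots> \<le> (\<integral>\<^sup>+ y. indicator {a..b} y \<partial>lborel)"
    using W_le_1 W_eq_0 by (intro nn_integral_mono) (auto split: split_indicator)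
  also have "\<dots> < \<infinity>" by (cases "a \<le> b") auto
  finally show "emeasure \<nu> UNIV \<noteq> \<infinity>" by auto
  show "emeasure \<nu> UNIV \<noteq> 0"
  proof
    assume "emeasure \<nu> UNIV = 0"
    then have "AE y in lborel. ennreal (W y) = 0"
      unfolding eq by (subst (asm) nn_integral_0_iff_AE) auto
    then have "AE y in lborel. W y = 0" by eventually_elim (use W_nonneg in \<open>auto simp: ennreal_eq_0_iff order_antisym\<close>)
    have "(LBINT y:{a..b}. w y) = (LBINT y. W y)"
      unfolding set_lebesgue_integral_def
      using a_pos W_eq W_eq_0 by (intro Bochner_Integration.integral_cong) (auto split: split_indicator)
    also have "\<dots> = 0"
      using \<open>AE y in lborel. W y = 0\<close> by (subst integral_cong_AE[where g="\<lambda>_. 0"]) auto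
    finally show False using w by (simp add: weights_def)
  qed
qed

lemma finite_measure_\<nu>: "finite_measure \<nu>"
  using emeasure_\<nu>(1) by (auto intro!: finite_measureI)

sublocale \<nu>: finite_measure \<nu>
  by (rule finite_measure_\<nu>)

sublocale \<nu>\<nu>: pair_sigma_finite \<nu> \<nu> ..

sublocale \<mu>: finite_measure \<mu>
  by (rule finite_measure_pair_measure; rule finite_measure_\<nu>)

lemma AE_\<nu>: "AE y in \<nu>. y \<in> {a..b}"
proof -
  have "y \<in> {a..b}" if "0 < W y" for y using W_eq_0[of y] that by force
  then show ?thesis unfolding \<nu>_def by (subst AE_density) (auto intro!: AE_I2)
qed

text \<open>Through this lemma the pointwise estimates for \<open>kappa\<close>, which assume
  heights of at least a, become almost everywhere bounds for \<open>\<mu>\<close>.\<close>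

lemma AE_\<mu>: "AE y in \<mu>. a \<le> fst y \<and> a \<le> snd y"
proof -
  have "AE y0 in \<nu>. AE y1 in \<nu>. a \<le> y0 \<and> a \<le> y1"
    using AE_\<nu> by eventually_elim (use AE_\<nu> in eventually_elim, auto)
  moreover have "{y \<in> space \<mu>. a \<le> fst y \<and> a \<le> snd y} = {a..} \<times> {a..}"
    by (auto simp: space_pair_measure)
  ultimately show ?thesis by (intro \<nu>\<nu>.AE_pair_measure) auto
qed

lemma \<mu>_eq_density: "\<mu> = density lborel (\<lambda>y. ennreal (W (fst y) * W (snd y)))"
proof -
  have "\<mu> = density (lborel \<Otimes>\<^sub>M lborel) (\<lambda>(x, y). ennreal (W x) * ennreal (W y))"
    unfolding \<nu>_def by (rule pair_measure_density)
      (auto intro: lborel.sigma_finite_measure_axioms \<nu>.sigma_finite_measure_axioms simp flip: \<nu>_def)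
  then show ?thesis by (simp add: lborel_prod split_beta' ennreal_mult W_nonneg)
qed

lemma integrable_kappa:
  assumes [measurable]: "f \<in> borel_measurable borel" and f: "\<And>y. \<bar>f y\<bar> \<le> C"
  shows "integrable \<mu> (\<lambda>y. f y * kappa r y)"
proof (rule \<mu>.integrable_const_bound)
  show "AE y in \<mu>. norm (f y * kappa r y) \<le> C * (1 / (16 * pi\<^sup>2 * a ^ 4))"
    using AE_\<mu>
  proof eventually_elim
    case (elim y)
    then have "0 \<le> kappa r y" "kappa r y \<le> 1 / (16 * pi\<^sup>2 * a ^ 4)"
      using a_pos kappa_nonneg[of y r] kappa_bound[of a "fst y" "snd y" r] by (auto simp: mem_Times_iff)
    moreover have "0 \<le> C" using f[of y] by linarith
    ultimately show ?case using f[of y] mult_mono[of "\<bar>f y\<bar>" C "kappa r y" "1 / (16 * pi\<^sup>2 * a ^ 4)"] by (simp add: abs_mult)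
  qed
qed simp

text \<open>The Lipschitz bound for \<open>kappa\<close> is uniform in the heights and so integrates
  against a finite measure. Allowing any bounded measurable f lets one estimate serve indicators,
  for total variation, and continuous functions, for weak continuity.\<close>

lemma integral_kappa_diff:
  assumes [measurable]: "f \<in> borel_measurable borel" and f: "\<And>y. \<bar>f y\<bar> \<le> C"
  shows "\<bar>(\<integral>y. f y * kappa r y \<partial>\<mu>) - (\<integral>y. f y * kappa s y \<partial>\<mu>)\<bar> \<le>
    C * (2 / (pi\<^sup>2 * (a\<^sup>2) ^ 3) * \<bar>r\<^sup>2 - s\<^sup>2\<bar>) * measure \<mu> (space \<mu>)"
proof -
  have "\<bar>(\<integral>y. f y * kappa r y \<partial>\<mu>) - (\<integral>y. f y * kappa s y \<partial>\<mu>)\<bar> =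
      norm (\<integral>y. f y * (kappa r y - kappa s y) \<partial>\<mu>)"
    using integrable_kappa[OF assms] by (simp add: right_diff_distrib)
  also have "\<dots> \<le> (\<integral>y. norm (f y * (kappa r y - kappa s y)) \<partial>\<mu>)"
    by (rule integral_norm_bound)
  also have "\<dots> \<le> (\<integral>y. C * (2 / (pi\<^sup>2 * (a\<^sup>2) ^ 3) * \<bar>r\<^sup>2 - s\<^sup>2\<bar>) \<partial>\<mu>)"
  proof (rule integral_mono_AE)
    show "integrable \<mu> (\<lambda>y. norm (f y * (kappa r y - kappa s y)))"
      using integrable_kappa[OF assms] by (intro integrable_norm) (simp add: right_diff_distrib)
    show "AE y in \<mu>. norm (f y * (kappa r y - kappa s y)) \<le> C * (2 / (pi\<^sup>2 * (a\<^sup>2) ^ 3) * \<bar>r\<^sup>2 - s\<^sup>2\<bar>)"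
      using AE_\<mu>
    proof eventually_elim
      case (elim y)
      have "0 \<le> C" using f[of y] by linarith
      then show ?case
        using f[of y] kappa_diff_bound[OF a_pos, of "fst y" "snd y" r s] elim
        unfolding real_norm_def abs_mult by (intro mult_mono) auto
    qed
  qed simp
  finally show ?thesis by (simp add: mult_ac)
qed

lemma continuous_integral_kappa:
  assumes "f \<in> borel_measurable borel" "\<And>y. \<bar>f y\<bar> \<le> C"
  shows "continuous_on UNIV (\<lambda>r. \<integral>y. f y * kappa r y \<partial>\<mu>)"
proof (clarsimp simp: continuous_on_def)
  fix s :: real
  have "((\<lambda>r. \<bar>r\<^sup>2 - s\<^sup>2\<bar>) \<longlongrightarrow> \<bar>s\<^sup>2 - s\<^sup>2\<bar>) (at s)"
    by (intro tendsto_rabs tendsto_diff tendsto_power tendsto_ident_at tendsto_const)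
  then have "((\<lambda>r. C * (2 / (pi\<^sup>2 * (a\<^sup>2) ^ 3) * \<bar>r\<^sup>2 - s\<^sup>2\<bar>) * measure \<mu> (space \<mu>)) \<longlongrightarrow> 0) (at s)"
    by (intro tendsto_mult_left_zero tendsto_mult_right_zero) simp
  then have "((\<lambda>r. (\<integral>y. f y * kappa r y \<partial>\<mu>) - (\<integral>y. f y * kappa s y \<partial>\<mu>)) \<longlongrightarrow> 0) (at s)"
    by (rule Lim_null_comparison[rotated])
      (simp only: real_norm_def integral_kappa_diff[OF assms] always_eventually simp_thms)
  then show "((\<lambda>r. \<integral>y. f y * kappa r y \<partial>\<mu>) \<longlongrightarrow> (\<integral>y. f y * kappa s y \<partial>\<mu>)) (at s)"
    by (simp add: LIM_zero_iff)
qed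

text \<open>The squared intensity is itself a double integral over \<open>\<mu>\<close>, so both
  terms of \<open>rho2\<close> merge into one integral of \<open>kappa\<close>. This exhibits
  \<open>rho2\<close> as the total mass that normalises \<open>Q\<close>.\<close>

lemma rho2_eq: "rho2 w r = (\<integral>y. kappa r y \<partial>\<mu>)"
proof -
  have \<nu>_int: "(\<integral>y. f y \<partial>\<nu>) = (LBINT y:{0<..}. w y * f y)" if [measurable]: "f \<in> borel_measurable borel" for f :: "real \<Rightarrow> real"
    unfolding \<nu>_def set_lebesgue_integral_def
    by (subst integral_density) (auto simp: W_nonneg, simp add: W_def mult.assoc)
  \<comment> \<open>The two pieces of \<open>kappa\<close> without their constants; each needs its
    own integrability proof before the integral of the difference can be split.\<close>
  let ?f = "\<lambda>y. 1 / y\<^sup>2 :: real" and ?g = "\<lambda>y. 1 / (r\<^sup>2 + (fst y + snd y)\<^sup>2)\<^sup>2 :: real"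
  have g: "integrable \<mu> ?g"
  proof (rule \<mu>.integrable_const_bound)
    show "AE y in \<mu>. norm (?g y) \<le> 1 / (a\<^sup>2)\<^sup>2"
      using AE_\<mu>
    proof eventually_elim
      case (elim y)
      then have "a\<^sup>2 \<le> (fst y + snd y)\<^sup>2" using a_pos by (intro power_mono) auto
      then have "a\<^sup>2 \<le> r\<^sup>2 + (fst y + snd y)\<^sup>2" by (auto intro: add_increasing)
      then have "(a\<^sup>2)\<^sup>2 \<le> (r\<^sup>2 + (fst y + snd y)\<^sup>2)\<^sup>2" by (intro power_mono) auto
      then have "1 / (r\<^sup>2 + (fst y + snd y)\<^sup>2)\<^sup>2 \<le> 1 / (a\<^sup>2)\<^sup>2"
        using a_pos by (intro divide_left_mono mult_pos_pos) (auto intro: less_le_trans)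
      then show ?case by simp
    qed
  qed simp
  have f1: "integrable \<nu> ?f"
  proof (rule \<nu>.integrable_const_bound)
    show "AE y in \<nu>. norm (?f y) \<le> 1 / a\<^sup>2"
      using AE_\<nu> by eventually_elim (use a_pos in \<open>auto intro!: divide_left_mono power_mono\<close>)
  qed simp
  have f: "integrable \<mu> (\<lambda>y. ?f (fst y) * ?f (snd y))"
  proof (rule \<mu>.integrable_const_bound)
    show "AE y in \<mu>. norm (?f (fst y) * ?f (snd y)) \<le> 1 / a\<^sup>2 * (1 / a\<^sup>2)"
      using AE_\<mu> by eventually_elim (use a_pos in \<open>auto simp: abs_mult simp del: times_divide_eq_left times_divide_eq_right intro!: mult_mono divide_left_mono power_mono\<close>)
  qed simp
  have "(\<integral>y. ?f (fst y) * ?f (snd y) \<partial>\<mu>) = (\<integral>y. ?f y \<partial>\<nu>)\<^sup>2"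
    by (subst \<nu>\<nu>.integral_fst'[symmetric, OF f]) (simp only: fst_conv snd_conv integral_mult_right_zero integral_mult_left_zero power2_eq_square)
  moreover have "(LBINT y:{0<..}. w y / y\<^sup>2) = (\<integral>y. ?f y \<partial>\<nu>)"
    by (subst \<nu>_int) auto
  ultimately have 1: "(intensity w)\<^sup>2 = 1 / (4 * pi)\<^sup>2 * (\<integral>y. ?f (fst y) * ?f (snd y) \<partial>\<mu>)"
    by (simp add: intensity_def power_mult_distrib power_divide)
  have "(LBINT y:{0<..}. LBINT v:{0<..}. w y * w v / (r\<^sup>2 + (y + v)\<^sup>2)\<^sup>2) =
      (LBINT y:{0<..}. w y * (\<integral>v. ?g (y, v) \<partial>\<nu>))"
    by (subst \<nu>_int) (auto simp: set_lebesgue_integral_def simp flip: integral_mult_right_zero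
      intro!: Bochner_Integration.integral_cong)
  also have "\<dots> = (\<integral>y. \<integral>v. ?g (y, v) \<partial>\<nu> \<partial>\<nu>)"
    by (rule \<nu>_int[symmetric]) measurable
  also have "\<dots> = (\<integral>y. ?g y \<partial>\<mu>)"
    by (rule \<nu>\<nu>.integral_fst'[OF g])
  finally have 2: "rho2 w r = (\<integral>y. 1 / (4 * pi)\<^sup>2 * (?f (fst y) * ?f (snd y)) - 1 / pi\<^sup>2 * ?g y \<partial>\<mu>)"
    unfolding rho2_def 1
    by (subst Bochner_Integration.integral_diff)
      (intro integrable_mult_right f g | simp only: integral_mult_right_zero)+
  show ?thesis unfolding 2
    by (intro Bochner_Integration.integral_cong) (auto simp: kappa_def power_mult_distrib)
qed

text \<open>If the integral of the nonnegative \<open>kappa\<close> vanished, almost every pair of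
  heights would satisfy y0 = y1 by \<open>kappa_eq_0D\<close>; but \<open>\<nu>\<close> is nonzero
  and has no atoms.\<close>

lemma rho2_pos: "0 < rho2 w r"
proof -
  have int: "integrable \<mu> (kappa r)" using integrable_kappa[of "\<lambda>_. 1" 1 r] by simp
  have nonneg: "AE y in \<mu>. 0 \<le> kappa r y"
    using AE_\<mu> by eventually_elim (use a_pos in \<open>auto intro!: kappa_nonneg simp: mem_Times_iff\<close>)
  have "(\<integral>y. kappa r y \<partial>\<mu>) \<noteq> 0"
  proof
    assume "(\<integral>y. kappa r y \<partial>\<mu>) = 0"
    then have "AE y in \<mu>. kappa r y = 0"
      using integral_nonneg_eq_0_iff_AE[OF int nonneg] by simp
    then have "AE y0 in \<nu>. AE y1 in \<nu>. kappa r (y0, y1) = 0"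
      by (rule \<nu>\<nu>.AE_pair[of "\<lambda>y. kappa r y = 0", simplified])
    then have "AE y0 in \<nu>. AE y1 in \<nu>. False"
      using AE_\<nu>
    proof eventually_elim
      case (elim y0)
      have "AE y1 in \<nu>. y1 \<noteq> y0"
        unfolding \<nu>_def using AE_lborel_singleton[of y0] by (subst AE_density) auto
      with elim(1) AE_\<nu> show ?case
        by eventually_elim (use a_pos elim(2) kappa_eq_0D[of r y0] in force)
    qed
    moreover have "\<not> (AE y in \<nu>. False)"
      using emeasure_\<nu>(2) by (simp add: AE_iff_null null_sets_def)
    ultimately show False by simp
  qed
  moreover have "0 \<le> (\<integral>y. kappa r y \<partial>\<mu>)" by (rule integral_nonneg_AE[OF nonneg])
  ultimately show ?thesis by (simp add: rho2_eq)
qed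

lemma continuous_rho2: "continuous_on UNIV (rho2 w)"
  using continuous_integral_kappa[of "\<lambda>_. 1" 1] by (simp add: rho2_eq[abs_def])

lemma sets_Q: "sets (Q w r) = sets (restrict_space borel quadrant)"
  by (simp add: Q_def sets_restrict_space)

lemma space_Q: "space (Q w r) = quadrant"
  by (simp add: Q_def space_restrict_space)

lemma quadrant_borel [measurable]: "quadrant \<in> sets (borel :: (real \<times> real) measure)"
  by (intro borel_open open_Times open_greaterThan)

lemma Q_density_measurable [measurable]:
  "(\<lambda>y. w (fst y) * w (snd y) / rho2 w r * kappa r y) \<in> borel_measurable (restrict_space lborel quadrant)"
proof -
  have "(\<lambda>y. W (fst y) * W (snd y) / rho2 w r * kappa r y) \<in> borel_measurable (restrict_space lborel quadrant)"
    by (rule measurable_restrict_space1) measurable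
  then show ?thesis
    by (rule iffD1[OF measurable_cong, rotated]) (auto simp: space_restrict_space W_eq)
qed

lemma Q_eq: "Q w r = density (restrict_space lborel quadrant)
    (\<lambda>y. ennreal (w (fst y) * w (snd y) / rho2 w r * kappa r y))"
  by (simp add: Q_def kappa_def split_beta')

text \<open>\<open>f\<close> is measurable on the quadrant only, so it is multiplied by the
  indicator before being integrated over the plane; the factor 1 / \<open>rho2 w r\<close> comes out
  of the integral.\<close>

lemma integral_Q:
  fixes f :: "real \<times> real \<Rightarrow> real"
  assumes f: "f \<in> borel_measurable (restrict_space borel quadrant)"
  shows "(\<integral>y. f y \<partial>Q w r) = (\<integral>y. (indicator quadrant y * f y) * kappa r y \<partial>\<mu>) / rho2 w r"
proof -
  have [measurable]: "f \<in> borel_measurable (restrict_space lborel quadrant)"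
    using f by (simp cong: measurable_cong_sets add: sets_restrict_space)
  have g [measurable]: "(\<lambda>y. indicator quadrant y * f y) \<in> borel_measurable borel"
    using f by (simp add: borel_measurable_restrict_space_iff)
  have "(\<integral>y. f y \<partial>Q w r) = (\<integral>y. (w (fst y) * w (snd y) / rho2 w r * kappa r y) * f y \<partial>restrict_space lborel quadrant)"
    unfolding Q_eq
  proof (subst integral_density)
    show "AE y in restrict_space lborel quadrant. 0 \<le> w (fst y) * w (snd y) / rho2 w r * kappa r y"
      using rho2_pos[of r] W_nonneg W_eq kappa_nonneg[of _ r]
      by (intro AE_I2) (auto simp: space_restrict_space intro!: mult_nonneg_nonneg divide_nonneg_pos, (metis)+)
  qed (simp_all add: Q_density_measurable[simplified])
  also have "\<dots> = (\<integral>y. W (fst y) * W (snd y) * ((indicator quadrant y * f y) * kappa r y) \<partial>lborel) / rho2 w r"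
    by (subst integral_restrict_space, simp, subst integral_divide_zero[symmetric])
      (auto intro!: Bochner_Integration.integral_cong simp: W_eq split: split_indicator)
  also have "(\<integral>y. W (fst y) * W (snd y) * ((indicator quadrant y * f y) * kappa r y) \<partial>lborel) =
      (\<integral>y. (indicator quadrant y * f y) * kappa r y \<partial>\<mu>)"
    unfolding \<mu>_eq_density by (subst integral_density) (auto simp: W_nonneg)
  finally show ?thesis .
qed

end

section \<open>Continuity and uniqueness\<close>

text \<open>Indicators of open sets are limits of continuous functions with values in [0, 1], and
  open sets form an intersection-stable generator of the Borel sets.\<close>

lemma measure_eqI_integral_continuous:
  fixes M N :: "'a::metric_space measure"
  assumes "prob_space M" "prob_space N" and sets [measurable_cong]: "sets M = sets borel" "sets N = sets borel"
    and eq: "\<And>f :: 'a \<Rightarrow> real. continuous_on UNIV f \<Longrightarrow> (\<And>x. 0 \<le> f x \<and> f x \<le> 1) \<Longrightarrow>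
      (\<integral>x. f x \<partial>M) = (\<integral>x. f x \<partial>N)"
  shows "M = N"
proof -
  interpret M: prob_space M by fact
  interpret N: prob_space N by fact
  have emeasure_eq: "emeasure M U = emeasure N U" if "open U" for U
  \<comment> \<open>For \<open>U = UNIV\<close> the complement is empty and \<open>infdist\<close>
    to it is 0 by convention, so the approximation below would fail; there both masses are
    1.\<close>
  proof (cases "U = UNIV")
    case True
    then show ?thesis
      using M.emeasure_space_1 N.emeasure_space_1 sets_eq_imp_space_eq[OF sets(1)] sets_eq_imp_space_eq[OF sets(2)]
      by simp
  next
    case False
    \<comment> \<open>Truncated multiples of the distance to the complement: 0 off \<open>U\<close>,
      and equal to 1 at each point of \<open>U\<close> once n is large.\<close>
    define f where "f n x = min 1 (real n * infdist x (- U))" for n x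
    have cont: "continuous_on UNIV (f n)" for n
      unfolding f_def by (intro continuous_intros)
    have [measurable]: "f n \<in> borel_measurable borel" for n
      by (rule borel_measurable_continuous_onI[OF cont])
    have [measurable]: "U \<in> sets borel" using that by simp
    have f01: "0 \<le> f n x \<and> f n x \<le> 1" for n x by (simp add: f_def infdist_nonneg)
    have lim: "(\<lambda>n. f n x) \<longlonglongrightarrow> indicator U x" for x
    proof (cases "x \<in> U")
      case True
      then have "infdist x (- U) \<noteq> 0"
        using that False in_closed_iff_infdist_zero[of "- U" x] by auto
      then have pos: "0 < infdist x (- U)" using infdist_nonneg[of x "- U"] by linarith
      then obtain m :: nat where m: "1 < real m * infdist x (- U)"
        using reals_Archimedean3 by blast
      have "eventually (\<lambda>n. f n x = 1) sequentially"
        using eventually_ge_at_top[of m]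
      proof eventually_elim
        case (elim n)
        then have "real m * infdist x (- U) \<le> real n * infdist x (- U)"
          using pos by (intro mult_right_mono) auto
        then show ?case using m by (simp add: f_def)
      qed
      then show ?thesis using True by (simp add: tendsto_eventually)
    qed (simp add: f_def)
    have "(\<lambda>n. \<integral>x. f n x \<partial>M) \<longlonglongrightarrow> (\<integral>x. indicator U x \<partial>M)"
      by (rule integral_dominated_convergence[where w = "\<lambda>_. 1"]) (use f01 lim in auto)
    moreover have "(\<lambda>n. \<integral>x. f n x \<partial>N) \<longlonglongrightarrow> (\<integral>x. indicator U x \<partial>N)"
      by (rule integral_dominated_convergence[where w = "\<lambda>_. 1"]) (use f01 lim in auto)
    ultimately have "(\<integral>x. indicator U x \<partial>M) = (\<integral>x. indicator U x \<partial>N :: real)"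
      using eq[OF cont f01] by (simp add: LIMSEQ_unique)
    then show ?thesis
      using sets_eq_imp_space_eq[OF sets(1)] sets_eq_imp_space_eq[OF sets(2)]
      by (simp add: M.emeasure_eq_measure N.emeasure_eq_measure)
  qed
  show ?thesis
  proof (rule measure_eqI_generator_eq[where E = "{U. open U}" and \<Omega> = UNIV and A = "\<lambda>_. UNIV"])
    show "Int_stable {U :: 'a set. open U}" by (auto simp: Int_stable_def)
    show "sets M = sigma_sets UNIV {U. open U}" "sets N = sigma_sets UNIV {U. open U}"
      by (simp_all add: sets borel_def)
  qed (auto simp: emeasure_eq)
qed

text \<open>The set where f and g differ is open, and a nonempty open set is not Lebesgue
  null.\<close>

lemma continuous_AE_eq_imp_eq:
  fixes f g :: "'a::euclidean_space \<Rightarrow> 'b::t2_space"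
  assumes "AE x in lborel. f x = g x" "continuous_on UNIV f" "continuous_on UNIV g"
  shows "f x = g x"
proof (rule ccontr)
  assume "f x \<noteq> g x"
  have op: "open {x. f x \<noteq> g x}"
    using assms(2,3) by (rule open_Collect_neq)
  have "{x. f x \<noteq> g x} \<in> null_sets lborel"
    using assms(1) op AE_iff_null[of lborel "\<lambda>x. f x = g x"] by auto
  then have "negligible {x. f x \<noteq> g x}"
    by (simp add: negligible_iff_null_sets null_sets_completionI)
  with open_not_negligible[OF op] \<open>f x \<noteq> g x\<close> show False by blast
qed

section \<open>Regularity of the kernel and its uniqueness\<close>

context height_weight
begin

lemma integral_kappa_quadrant: "(\<integral>y. indicator quadrant y * kappa r y \<partial>\<mu>) = rho2 w r"
  unfolding rho2_eq
proof (rule integral_cong_AE)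
  show "AE y in \<mu>. indicator quadrant y * kappa r y = kappa r y"
    using AE_\<mu> by eventually_elim (use a_pos in \<open>auto simp: mem_Times_iff\<close>)
qed simp_all

lemma measure_Q:
  assumes "A \<in> sets (Q w r)"
  shows "measure (Q w r) A = (\<integral>y. indicator A y * kappa r y \<partial>\<mu>) / rho2 w r"
proof -
  have A: "A \<subseteq> quadrant" "A \<in> sets (restrict_space borel quadrant)"
    using assms sets.sets_into_space[OF assms] by (auto simp: sets_Q space_Q)
  then have eq: "indicator quadrant y * indicator A y = (indicator A y :: real)" for y
    by (auto split: split_indicator)
  have "measure (Q w r) A = (\<integral>y. indicator A y \<partial>Q w r)"
    using A(1) by (simp add: space_Q Int_absorb2)
  also have "\<dots> = (\<integral>y. indicator A y * kappa r y \<partial>\<mu>) / rho2 w r"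
    unfolding integral_Q[OF borel_measurable_indicator[OF A(2)]] eq ..
  finally show ?thesis .
qed

lemma sets_Q_borel: "A \<in> sets (Q w r) \<Longrightarrow> A \<in> sets borel"
  by (simp add: sets_Q sets_restrict_space_iff)

lemma prob_space_Q: "prob_space (Q w r)"
proof
  have "measure (Q w r) (space (Q w r)) = 1"
    using rho2_pos[of r] by (simp add: measure_Q integral_kappa_quadrant space_Q sets_Q sets_restrict_space_iff)
  moreover from this have "emeasure (Q w r) (space (Q w r)) \<noteq> \<infinity>"
    by (auto simp: measure_def)
  ultimately show "emeasure (Q w r) (space (Q w r)) = 1"
    by (simp add: emeasure_eq_ennreal_measure)
qed

lemma prob_family_Q: "prob_family_on quadrant (Q w)"
  by (simp add: prob_family_on_def prob_space_Q space_Q sets_Q)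

lemma weakly_continuous_Q: "weakly_continuous_on quadrant (Q w)"
  unfolding weakly_continuous_on_def
proof (intro allI impI, elim conjE)
  fix f :: "real \<times> real \<Rightarrow> real"
  assume f: "continuous_on quadrant f" "bounded (f ` quadrant)"
  have f_meas: "f \<in> borel_measurable (restrict_space borel quadrant)"
    by (rule borel_measurable_continuous_on_restrict[OF f(1)])
  obtain C where C: "\<And>y. y \<in> quadrant \<Longrightarrow> \<bar>f y\<bar> \<le> C" "0 \<le> C"
    using f(2) unfolding bounded_pos by (force intro: less_imp_le)
  have "continuous_on UNIV (\<lambda>r. \<integral>y. (indicator quadrant y * f y) * kappa r y \<partial>\<mu>)"
  proof (rule continuous_integral_kappa)
    show "(\<lambda>y. indicator quadrant y * f y) \<in> borel_measurable borel"
      using f_meas by (simp add: borel_measurable_restrict_space_iff)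
    show "\<bar>indicator quadrant y * f y\<bar> \<le> C" for y
      using C by (auto split: split_indicator)
  qed
  then show "continuous_on UNIV (\<lambda>r. \<integral>y. f y \<partial>Q w r)"
    unfolding integral_Q[OF f_meas]
    using rho2_pos by (intro continuous_on_divide continuous_rho2) (auto simp: less_imp_neq[symmetric])
qed

lemma tv_continuous_Q: "tv_continuous (Q w)"
  unfolding tv_continuous_def
proof
  fix s :: real
  \<comment> \<open>The constant of \<open>integral_kappa_diff\<close> for test functions bounded by
    1.\<close>
  define K where "K = 2 / (pi\<^sup>2 * (a\<^sup>2) ^ 3) * measure \<mu> (space \<mu>)"
  have diff: "\<bar>measure (Q w r) A - measure (Q w s) A\<bar> \<le> 2 * (K * \<bar>r\<^sup>2 - s\<^sup>2\<bar>) / rho2 w r"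
    if A: "A \<in> sets (Q w r)" for A r
  proof -
    interpret Q: prob_space "Q w s" by (rule prob_space_Q)
    have A': "A \<in> sets (Q w s)" using A by (simp add: sets_Q)
    have [measurable]: "A \<in> sets borel" using A by (rule sets_Q_borel)
    let ?G = "\<lambda>r. \<integral>y. indicator A y * kappa r y \<partial>\<mu>"
    have G: "\<bar>?G r - ?G s\<bar> \<le> K * \<bar>r\<^sup>2 - s\<^sup>2\<bar>"
      using integral_kappa_diff[of "indicator A" 1 r s] by (simp add: K_def mult_ac)
    have \<rho>: "\<bar>rho2 w r - rho2 w s\<bar> \<le> K * \<bar>r\<^sup>2 - s\<^sup>2\<bar>"
      using integral_kappa_diff[of "\<lambda>_. 1" 1 r s] by (simp add: K_def rho2_eq mult_ac)
    define m where "m = measure (Q w s) A"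
    have m: "0 \<le> m" "m \<le> 1" by (auto simp: m_def)
    have Gs: "?G s = m * rho2 w s"
      using rho2_pos[of s] by (simp add: m_def measure_Q[OF A'])
    \<comment> \<open>A difference of quotients, rewritten with \<open>?G s = m * rho2 w s\<close>
      so that a single denominator remains. As m \<le> 1, each of the two numerator terms is at most
      K |r^2 - s^2|, whence the factor 2.\<close>
    have "measure (Q w r) A - m = ((?G r - ?G s) - m * (rho2 w r - rho2 w s)) / rho2 w r"
      using rho2_pos[of r] unfolding measure_Q[OF A] Gs by (simp add: field_simps)
    moreover have "\<bar>(?G r - ?G s) - m * (rho2 w r - rho2 w s)\<bar> \<le> 2 * (K * \<bar>r\<^sup>2 - s\<^sup>2\<bar>)"
    proof -
      have "\<bar>m * (rho2 w r - rho2 w s)\<bar> \<le> 1 * (K * \<bar>r\<^sup>2 - s\<^sup>2\<bar>)"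
        unfolding abs_mult using m \<rho> by (intro mult_mono) auto
      with G show ?thesis by linarith
    qed
    ultimately show ?thesis
      using rho2_pos[of r] by (simp add: m_def divide_right_mono)
  qed
  \<comment> \<open>The bound in \<open>diff\<close> does not depend on \<open>A\<close>, so it
    passes to the supremum; comparison with the empty set shows that the supremum is
    nonnegative.\<close>
  have bound: "\<bar>tv_dist (Q w r) (Q w s)\<bar> \<le> 2 * (K * \<bar>r\<^sup>2 - s\<^sup>2\<bar>) / rho2 w r" for r
  proof -
    have "tv_dist (Q w r) (Q w s) \<le> 2 * (K * \<bar>r\<^sup>2 - s\<^sup>2\<bar>) / rho2 w r"
      unfolding tv_dist_def using diff by (intro cSUP_least) auto
    moreover have "\<bar>measure (Q w r) {} - measure (Q w s) {}\<bar> \<le> tv_dist (Q w r) (Q w s)"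
      unfolding tv_dist_def using diff
      by (intro cSUP_upper bdd_aboveI2[where M = "2 * (K * \<bar>r\<^sup>2 - s\<^sup>2\<bar>) / rho2 w r"]) auto
    ultimately show ?thesis by simp
  qed
  have "((\<lambda>r. rho2 w r) \<longlongrightarrow> rho2 w s) (at s)"
    using continuous_rho2 by (simp add: continuous_on_def)
  moreover have "((\<lambda>r. \<bar>r\<^sup>2 - s\<^sup>2\<bar>) \<longlongrightarrow> \<bar>s\<^sup>2 - s\<^sup>2\<bar>) (at s)"
    by (intro tendsto_rabs tendsto_diff tendsto_power tendsto_ident_at tendsto_const)
  ultimately have "((\<lambda>r. 2 * (K * \<bar>r\<^sup>2 - s\<^sup>2\<bar>) / rho2 w r) \<longlongrightarrow> 2 * (K * \<bar>s\<^sup>2 - s\<^sup>2\<bar>) / rho2 w s) (at s)"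
    using rho2_pos[of s] by (intro tendsto_divide tendsto_mult tendsto_const) auto
  then have "((\<lambda>r. 2 * (K * \<bar>r\<^sup>2 - s\<^sup>2\<bar>) / rho2 w r) \<longlongrightarrow> 0) (at s)" by simp
  then show "((\<lambda>r. tv_dist (Q w r) (Q w s)) \<longlongrightarrow> 0) (at s)"
    by (rule Lim_null_comparison[rotated]) (simp add: bound)
qed

text \<open>The expectation over pairs does not mention the kernel, so the right sides for
  \<open>p\<close> and \<open>q\<close> agree for every \<open>H\<close>.\<close>

lemma pair_disintegration_unique:
  assumes "prob_family_on quadrant p" "weakly_continuous_on quadrant p" "pair_disintegration P M w p"
    and "prob_family_on quadrant q" "weakly_continuous_on quadrant q" "pair_disintegration P M w q"
  shows "p r = q r"
proof -
  define I where "I k f r = rho2 w r * (\<integral>y. f y \<partial>k r)"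
    for k :: "real \<Rightarrow> (real \<times> real) measure" and f :: "real \<times> real \<Rightarrow> real" and r
  have I_cont: "continuous_on UNIV (I k f)"
    if "weakly_continuous_on quadrant k" "continuous_on UNIV f" "\<And>y. 0 \<le> f y \<and> f y \<le> 1" for k f
  proof -
    have "continuous_on quadrant f" using that(2) continuous_on_subset by blast
    moreover have "bounded (f ` quadrant)"
      using that(3) by (auto intro!: boundedI[where B = 1])
    ultimately show ?thesis
      using that(1) unfolding I_def weakly_continuous_on_def by (intro continuous_on_mult continuous_rho2) auto
  qed
  \<comment> \<open>A product test function: the indicator of [0, 1] integrates to 1 in x and so
    removes that variable, \<open>B\<close> localises r, and f tests the heights.\<close>
  have test: "(\<integral>\<^sup>+ \<omega>. (\<integral>\<^sup>+ (z0, z1). (\<lambda>(x, r, y). indicator {0..1} x * (indicator B r * ennreal (f y)))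
              (Re z0, Re z1 - Re z0, Im z0, Im z1)
              \<partial>count_space {(z0, z1). z0 \<in> M \<omega> \<and> z1 \<in> M \<omega> \<and> z0 \<noteq> z1}) \<partial>P) =
      (\<integral>\<^sup>+ r\<in>B. ennreal (I k f r) \<partial>lborel)"
    if k: "prob_family_on quadrant k" "weakly_continuous_on quadrant k" "pair_disintegration P M w k"
      and f: "continuous_on UNIV f" "\<And>y. 0 \<le> f y \<and> f y \<le> 1" and [measurable]: "B \<in> sets borel" for k f B
  proof -
    have f_meas [measurable]: "f \<in> borel_measurable borel"
      by (rule borel_measurable_continuous_onI[OF f(1)])
    have [measurable]: "I k f \<in> borel_measurable borel"
      by (rule borel_measurable_continuous_onI[OF I_cont[OF k(2) f]])
    have inner: "ennreal (rho2 w r) * (\<integral>\<^sup>+ y. ennreal (f y) \<partial>k r) = ennreal (I k f r)" for r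
    proof -
      interpret k: prob_space "k r" using k(1) by (simp add: prob_family_on_def)
      have "f \<in> borel_measurable (restrict_space borel quadrant)"
        by (rule measurable_restrict_space1) measurable
      moreover have "sets (k r) = sets (restrict_space borel quadrant)"
        using k(1) by (simp add: prob_family_on_def)
      ultimately have "f \<in> borel_measurable (k r)" by (simp cong: measurable_cong_sets)
      then have "integrable (k r) f"
        using f(2) by (intro k.integrable_const_bound[where B = 1]) auto
      then show ?thesis
        using f(2) rho2_pos[of r] by (simp add: I_def nn_integral_eq_integral ennreal_mult integral_nonneg)
    qed
    let ?H = "\<lambda>(x :: real, r :: real, y :: real \<times> real). indicator {0..1} x * (indicator B r * ennreal (f y)) :: ennreal"
    have "?H \<in> borel_measurable (borel :: (real \<times> real \<times> real \<times> real) measure)"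
      unfolding case_prod_unfold by measurable
    then have "?H \<in> borel_measurable (restrict_space borel (UNIV \<times> UNIV \<times> quadrant))"
      by (rule measurable_restrict_space1)
    from k(3)[unfolded pair_disintegration_def, rule_format, OF this]
    have "(\<integral>\<^sup>+ \<omega>. (\<integral>\<^sup>+ (z0, z1). ?H (Re z0, Re z1 - Re z0, Im z0, Im z1)
              \<partial>count_space {(z0, z1). z0 \<in> M \<omega> \<and> z1 \<in> M \<omega> \<and> z0 \<noteq> z1}) \<partial>P) =
        (\<integral>\<^sup>+ x. \<integral>\<^sup>+ r. ennreal (rho2 w r) * (\<integral>\<^sup>+ (y0, y1). ?H (x, r, y0, y1) \<partial>k r)
              \<partial>lborel \<partial>lborel)" .
    also have "\<dots> = (\<integral>\<^sup>+ x. \<integral>\<^sup>+ r. indicator {0..1::real} x * (ennreal (I k f r) * indicator B r) \<partial>lborel \<partial>lborel)"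
    proof (intro nn_integral_cong)
      fix x r :: real
      have "(\<integral>\<^sup>+ (y0, y1). ?H (x, r, y0, y1) \<partial>k r) =
          indicator {0..1} x * (indicator B r * (\<integral>\<^sup>+ y. ennreal (f y) \<partial>k r))"
        by (auto simp: case_prod_unfold split: split_indicator)
      then show "ennreal (rho2 w r) * (\<integral>\<^sup>+ (y0, y1). ?H (x, r, y0, y1) \<partial>k r) =
          indicator {0..1} x * (ennreal (I k f r) * indicator B r)"
        by (simp add: inner[symmetric] mult_ac)
    qed
    also have "\<dots> = (\<integral>\<^sup>+ r\<in>B. ennreal (I k f r) \<partial>lborel)"
      by (simp add: nn_integral_cmult nn_integral_multc)
    finally show ?thesis .
  qed
  have eq: "(\<integral>y. f y \<partial>p r) = (\<integral>y. f y \<partial>q r)"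
    if f: "continuous_on UNIV f" "\<And>y. 0 \<le> f y \<and> f y \<le> 1" for f :: "real \<times> real \<Rightarrow> real"
  proof -
    have nonneg: "0 \<le> I k f s" for k s
      unfolding I_def using f(2) rho2_pos[of s] by (intro mult_nonneg_nonneg integral_nonneg) auto
    have [measurable]: "I p f \<in> borel_measurable borel" "I q f \<in> borel_measurable borel"
      by (rule borel_measurable_continuous_onI, rule I_cont; fact)+
    \<comment> \<open>\<open>test\<close> holds for every Borel set \<open>B\<close>, so the two
      densities define the same measure and therefore agree almost everywhere.\<close>
    have "density lborel (\<lambda>r. ennreal (I p f r)) = density lborel (\<lambda>r. ennreal (I q f r))"
    proof (rule measure_eqI)
      fix B assume "B \<in> sets (density lborel (\<lambda>r. ennreal (I p f r)))"
      then have B: "B \<in> sets borel" by simp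
      show "emeasure (density lborel (\<lambda>r. ennreal (I p f r))) B = emeasure (density lborel (\<lambda>r. ennreal (I q f r))) B"
        using test[OF assms(1-3) f B] test[OF assms(4-6) f B] B by (simp add: emeasure_density)
    qed simp
    then have "AE s in lborel. ennreal (I p f s) = ennreal (I q f s)"
      by (intro sigma_finite_measure.density_unique[OF lborel.sigma_finite_measure_axioms]) auto
    then have "AE s in lborel. I p f s = I q f s"
      by eventually_elim (simp add: nonneg)
    then have "I p f r = I q f r"
      by (rule continuous_AE_eq_imp_eq) (rule I_cont; fact)+
    then show ?thesis using rho2_pos[of r] by (simp add: I_def)
  qed
  have sets: "sets (p r) = sets (restrict_space borel quadrant)" "sets (q r) = sets (restrict_space borel quadrant)"
    and space: "space (p r) = quadrant" "space (q r) = quadrant"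
    using assms by (auto simp: prob_family_on_def)
  have id: "(\<lambda>y. y) \<in> p r \<rightarrow>\<^sub>M borel" "(\<lambda>y. y) \<in> q r \<rightarrow>\<^sub>M borel"
    by (auto simp: sets cong: measurable_cong_sets intro: measurable_restrict_space1)
  interpret p: prob_space "p r" using assms(1) by (simp add: prob_family_on_def)
  interpret q: prob_space "q r" using assms(4) by (simp add: prob_family_on_def)
  \<comment> \<open>The kernels live on the quadrant, while the continuous test functions are
    defined on the plane; pushing forward along the inclusion puts both measures on the Borel sets
    of the plane.\<close>
  have distr_eq: "distr (p r) borel (\<lambda>y. y) = distr (q r) borel (\<lambda>y. y)"
    using id eq
    by (intro measure_eqI_integral_continuous p.prob_space_distr q.prob_space_distr)
      (simp_all add: integral_distr borel_measurable_continuous_onI)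
  show ?thesis
  proof (rule measure_eqI)
    fix A assume A: "A \<in> sets (p r)"
    then have A': "A \<in> sets borel" "A \<subseteq> quadrant" by (auto simp: sets sets_restrict_space_iff)
    have "emeasure (p r) A = emeasure (distr (p r) borel (\<lambda>y. y)) A"
      using id A' by (simp add: emeasure_distr space vimage_def Int_absorb2)
    also have "\<dots> = emeasure (q r) A"
      unfolding distr_eq using id A' by (simp add: emeasure_distr space vimage_def Int_absorb2)
    finally show "emeasure (p r) A = emeasure (q r) A" .
  qed (simp add: sets)
qed

end

section \<open>The disintegration\<close>

lemma borel_measurable_Re_Im_cnj [measurable]: "Re \<in> borel_measurable borel" "Im \<in> borel_measurable borel"
  "cnj \<in> borel_measurable borel"
  by (auto intro!: borel_measurable_continuous_onI continuous_intros)

lemma borel_measurable_K_H [measurable]: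
  "(\<lambda>x. K_H (f x) (g x)) \<in> borel_measurable M"
  if [measurable]: "f \<in> borel_measurable M" "g \<in> borel_measurable M"
  unfolding K_H_def by measurable

text \<open>z - cnj z is purely imaginary, so its square is -4 (Im z)^2 and the sign cancels the
  minus in \<open>K_H\<close>.\<close>

lemma K_H_diag: "K_H z z = of_real (1 / (4 * pi * (Im z)\<^sup>2))"
proof -
  have "(z - cnj z)\<^sup>2 = of_real (- (4 * (Im z)\<^sup>2))"
    unfolding complex_diff_cnj by (simp add: power_mult_distrib)
  then show ?thesis by (simp add: K_H_def)
qed

text \<open>The kernel is Hermitian, so this is the squared modulus of \<open>K_H z \<zeta>\<close>.
  The two factors z - cnj \<zeta> and \<zeta> - cnj z multiply to -|z - cnj \<zeta>|^2, and squaring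
  removes the sign.\<close>

lemma K_H_mult_swap:
  "K_H z \<zeta> * K_H \<zeta> z = of_real (1 / (pi\<^sup>2 * ((Re \<zeta> - Re z)\<^sup>2 + (Im z + Im \<zeta>)\<^sup>2)\<^sup>2))"
proof -
  have "(z - cnj \<zeta>) * (\<zeta> - cnj z) = - of_real ((Re \<zeta> - Re z)\<^sup>2 + (Im z + Im \<zeta>)\<^sup>2)"
    by (rule complex_eqI) (simp_all add: power2_eq_square algebra_simps)
  then have "(z - cnj \<zeta>)\<^sup>2 * (\<zeta> - cnj z)\<^sup>2 = of_real (((Re \<zeta> - Re z)\<^sup>2 + (Im z + Im \<zeta>)\<^sup>2)\<^sup>2)"
    by (simp only: power_mult_distrib[symmetric] power2_minus of_real_power)
  moreover have "K_H z \<zeta> * K_H \<zeta> z = 1 / (of_real (pi\<^sup>2) * ((z - cnj \<zeta>)\<^sup>2 * (\<zeta> - cnj z)\<^sup>2))"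
    by (simp add: K_H_def power2_eq_square mult_ac)
  ultimately show ?thesis by simp
qed

lemma K_H_two_point:
  "Re (K_H z z * K_H \<zeta> \<zeta> - K_H z \<zeta> * K_H \<zeta> z) = kappa (Re \<zeta> - Re z) (Im z, Im \<zeta>)"
  unfolding K_H_diag K_H_mult_swap of_real_mult[symmetric] of_real_diff[symmetric] Re_complex_of_real
  by (simp add: kappa_def power2_eq_square mult_ac)

lemma half_plane_borel [measurable]: "half_plane \<in> sets borel"
  unfolding half_plane_def by (intro borel_open open_halfspace_Im_gt)

lemma nn_integral_lborel_pair:
  fixes f :: "real \<times> real \<Rightarrow> ennreal"
  assumes [measurable]: "f \<in> borel_measurable borel"
  shows "(\<integral>\<^sup>+ y. f y \<partial>lborel) = (\<integral>\<^sup>+ y0. \<integral>\<^sup>+ y1. f (y0, y1) \<partial>lborel \<partial>lborel)"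
proof -
  have "f \<in> borel_measurable (lborel \<Otimes>\<^sub>M lborel)" unfolding lborel_prod by simp
  from lborel.nn_integral_fst[OF this] show ?thesis by (simp add: lborel_prod)
qed

text \<open>For fixed x0 the substitution r = x1 - x0 is a translation and preserves Lebesgue
  measure. The order changes too: x1 is integrated inside y0 on the left, r outside it on the right,
  hence the Fubini step.\<close>

lemma nn_integral_shear:
  fixes f :: "real \<Rightarrow> real \<Rightarrow> real \<Rightarrow> real \<Rightarrow> ennreal"
  assumes [measurable]: "(\<lambda>(x, r, y0, y1). f x r y0 y1) \<in>
    borel_measurable (borel \<Otimes>\<^sub>M borel \<Otimes>\<^sub>M borel \<Otimes>\<^sub>M borel)"
  shows "(\<integral>\<^sup>+ x0. \<integral>\<^sup>+ y0. \<integral>\<^sup>+ x1. \<integral>\<^sup>+ y1. f x0 (x1 - x0) y0 y1 \<partial>lborel \<partial>lborel \<partial>lborel \<partial>lborel) =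
    (\<integral>\<^sup>+ x. \<integral>\<^sup>+ r. \<integral>\<^sup>+ y0. \<integral>\<^sup>+ y1. f x r y0 y1 \<partial>lborel \<partial>lborel \<partial>lborel \<partial>lborel)"
proof (rule nn_integral_cong)
  fix x0 :: real
  have [measurable]: "(\<lambda>z. f x0 (fst z) (fst (snd z)) (snd (snd z))) \<in> borel_measurable (borel \<Otimes>\<^sub>M borel \<Otimes>\<^sub>M borel)"
    using measurable_compose[OF measurable_Pair1'[of x0 borel] assms] by (simp add: case_prod_unfold)
  have "(\<integral>\<^sup>+ y0. \<integral>\<^sup>+ x1. \<integral>\<^sup>+ y1. f x0 (x1 - x0) y0 y1 \<partial>lborel \<partial>lborel \<partial>lborel) =
      (\<integral>\<^sup>+ x1. \<integral>\<^sup>+ y0. \<integral>\<^sup>+ y1. f x0 (x1 - x0) y0 y1 \<partial>lborel \<partial>lborel \<partial>lborel)"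
  proof (rule lborel_pair.Fubini')
    have "(\<lambda>z. f x0 (fst (fst z) - x0) (snd (fst z)) (snd z)) \<in> borel_measurable ((lborel \<Otimes>\<^sub>M lborel) \<Otimes>\<^sub>M lborel)"
      using measurable_compose[of "\<lambda>z. (fst (fst z) - x0, snd (fst z), snd z)" "(lborel \<Otimes>\<^sub>M lborel) \<Otimes>\<^sub>M lborel" "borel \<Otimes>\<^sub>M borel \<Otimes>\<^sub>M borel"
          "\<lambda>z. f x0 (fst z) (fst (snd z)) (snd (snd z))" borel] by simp
    from lborel.borel_measurable_nn_integral_fst[OF this]
    show "(\<lambda>(x1, y0). \<integral>\<^sup>+ y1. f x0 (x1 - x0) y0 y1 \<partial>lborel) \<in> borel_measurable (lborel \<Otimes>\<^sub>M lborel)"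
      by (simp add: case_prod_unfold)
  qed
  also have "\<dots> = (\<integral>\<^sup>+ r. \<integral>\<^sup>+ y0. \<integral>\<^sup>+ y1. f x0 r y0 y1 \<partial>lborel \<partial>lborel \<partial>lborel)"
  proof -
    let ?g = "\<lambda>r. \<integral>\<^sup>+ y0. \<integral>\<^sup>+ y1. f x0 r y0 y1 \<partial>lborel \<partial>lborel"
    have "(\<lambda>z. f x0 (fst (fst z)) (snd (fst z)) (snd z)) \<in> borel_measurable ((borel \<Otimes>\<^sub>M lborel) \<Otimes>\<^sub>M lborel)"
      using measurable_compose[of "\<lambda>z. (fst (fst z), snd (fst z), snd z)" "(borel \<Otimes>\<^sub>M lborel) \<Otimes>\<^sub>M lborel" "borel \<Otimes>\<^sub>M borel \<Otimes>\<^sub>M borel"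
          "\<lambda>z. f x0 (fst z) (fst (snd z)) (snd (snd z))" borel] by simp
    from lborel.borel_measurable_nn_integral_fst[OF lborel.borel_measurable_nn_integral_fst[OF this]]
    have "?g \<in> borel_measurable borel" by simp
    \<comment> \<open>The substitution r = -x0 + 1 * x1.\<close>
    from nn_integral_real_affine[OF this, of 1 "- x0"] show ?thesis by simp
  qed
  finally show "(\<integral>\<^sup>+ y0. \<integral>\<^sup>+ x1. \<integral>\<^sup>+ y1. f x0 (x1 - x0) y0 y1 \<partial>lborel \<partial>lborel \<partial>lborel) =
    (\<integral>\<^sup>+ r. \<integral>\<^sup>+ y0. \<integral>\<^sup>+ y1. f x0 r y0 y1 \<partial>lborel \<partial>lborel \<partial>lborel)" .
qed

section \<open>Assembling the disintegration\<close>

context height_weight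
begin

text \<open>Multiplication by \<open>rho2 w r\<close> cancels the normalising factor of
  \<open>Q\<close> and leaves weights times two-point determinant. As \<open>f\<close> vanishes off
  the quadrant, the integral may run over the plane with \<open>W\<close> in place of
  \<open>w\<close>.\<close>

lemma nn_integral_Q:
  fixes f :: "real \<times> real \<Rightarrow> ennreal"
  assumes [measurable]: "f \<in> borel_measurable borel" and f0: "\<And>y. y \<notin> quadrant \<Longrightarrow> f y = 0"
  shows "ennreal (rho2 w r) * (\<integral>\<^sup>+ y. f y \<partial>Q w r) =
    (\<integral>\<^sup>+ y0. \<integral>\<^sup>+ y1. f (y0, y1) * ennreal (W y0 * W y1) * ennreal (kappa r (y0, y1)) \<partial>lborel \<partial>lborel)"
proof -
  have f_meas: "f \<in> borel_measurable (restrict_space lborel quadrant)"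
    by (rule measurable_restrict_space1) measurable
  define d where "d y = ennreal (w (fst y) * w (snd y) / rho2 w r * kappa r y)" for y
  have d_meas: "d \<in> borel_measurable (restrict_space lborel quadrant)"
    unfolding d_def by (intro measurable_compose[OF Q_density_measurable] measurable_ennreal)
  have "(\<integral>\<^sup>+ y. f y \<partial>Q w r) = (\<integral>\<^sup>+ y. d y * f y \<partial>restrict_space lborel quadrant)"
    unfolding Q_eq d_def[symmetric] using d_meas f_meas by (rule nn_integral_density)
  also have "ennreal (rho2 w r) * \<dots> = (\<integral>\<^sup>+ y. ennreal (rho2 w r) * (d y * f y) \<partial>restrict_space lborel quadrant)"
    by (intro nn_integral_cmult[symmetric] borel_measurable_times_ennreal d_meas f_meas)
  also have "\<dots> = (\<integral>\<^sup>+ y. f y * ennreal (W (fst y) * W (snd y)) * ennreal (kappa r y) \<partial>lborel)"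
  proof (subst nn_integral_restrict_space, simp, intro nn_integral_cong)
    fix y
    show "ennreal (rho2 w r) * (d y * f y) * indicator quadrant y =
        f y * ennreal (W (fst y) * W (snd y)) * ennreal (kappa r y)"
    proof (cases "y \<in> quadrant")
      case True
      then have W: "W (fst y) = w (fst y)" "W (snd y) = w (snd y)" by (auto intro: W_eq)
      have nonneg: "0 \<le> w (fst y)" "0 \<le> w (snd y)" "0 \<le> kappa r y"
        using W_nonneg[of "fst y"] W_nonneg[of "snd y"] kappa_nonneg[OF True] by (auto simp: W)
      have "ennreal (rho2 w r) * d y =
          ennreal (rho2 w r * (w (fst y) * w (snd y) / rho2 w r * kappa r y))"
        unfolding d_def using rho2_pos[of r] nonneg by (intro ennreal_mult[symmetric] mult_nonneg_nonneg divide_nonneg_pos) auto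
      also have "\<dots> = ennreal (w (fst y) * w (snd y)) * ennreal (kappa r y)"
        using rho2_pos[of r] nonneg by (simp add: ennreal_mult[symmetric])
      finally have "ennreal (rho2 w r) * d y * f y = ennreal (w (fst y) * w (snd y)) * ennreal (kappa r y) * f y"
        by simp
      then show ?thesis using True unfolding W by (simp add: mult_ac)
    qed (simp add: f0)
  qed
  also have "\<dots> = (\<integral>\<^sup>+ y0. \<integral>\<^sup>+ y1. f (y0, y1) * ennreal (W y0 * W y1) * ennreal (kappa r (y0, y1)) \<partial>lborel \<partial>lborel)"
    by (subst nn_integral_lborel_pair) simp_all
  finally show ?thesis .
qed

lemma pair_disintegration_Q:
  assumes det: "determinantal_process P half_plane K_H Z"
    and thin: "independent_thinning P Z (\<lambda>z. w (Im z)) M"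
  shows "pair_disintegration P M w (Q w)"
  unfolding pair_disintegration_def
proof (intro allI impI)
  fix H :: "real \<times> real \<times> real \<times> real \<Rightarrow> ennreal"
  assume H: "H \<in> borel_measurable (restrict_space borel (UNIV \<times> UNIV \<times> quadrant))"
  interpret prob_space P using det by (simp add: determinantal_process_def point_process_on_def)
  have Z: "Z \<omega> \<subseteq> half_plane" if "\<omega> \<in> space P" for \<omega>
    using det that by (auto simp: determinantal_process_def point_process_on_def)
  \<comment> \<open>The enumeration of \<open>Z\<close> inside the thinning is unpacked because the
    determinantal lemma takes it as data.\<close>
  obtain N :: "'a \<Rightarrow> enat" and X :: "nat \<Rightarrow> 'a \<Rightarrow> complex" and U :: "nat \<Rightarrow> 'a \<Rightarrow> real" where
    enum: "\<forall>\<omega>\<in>space P. inj_on (\<lambda>n. X n \<omega>) {n. enat n < N \<omega>} \<and> Z \<omega> = {X n \<omega> | n. enat n < N \<omega>}" and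
    N [measurable]: "N \<in> P \<rightarrow>\<^sub>M count_space UNIV" and X: "\<forall>n. X n \<in> P \<rightarrow>\<^sub>M borel" and
    M: "\<forall>\<omega>\<in>space P. M \<omega> = {X n \<omega> | n. enat n < N \<omega> \<and> U n \<omega> \<le> w (Im (X n \<omega>))}"
    using thin unfolding independent_thinning_def by (elim exE conjE) (rule that)
  have M_subset: "M \<omega> \<subseteq> half_plane" if "\<omega> \<in> space P" for \<omega>
    using Z[OF that] enum M that by fastforce
  let ?S = "UNIV \<times> UNIV \<times> quadrant"
  \<comment> \<open>\<open>H\<close> is measurable only over the quadrant. Its extension by zero is
    Borel because \<open>?S\<close> is open, and it agrees with \<open>H\<close> at all pairs of
    points of the half-plane.\<close>
  define G where "G z = H z * indicator ?S z" for z
  have "open (?S :: (real \<times> real \<times> real \<times> real) set)"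
    by (intro open_Times open_greaterThan open_UNIV)
  then have "?S \<inter> space borel \<in> sets (borel :: (real \<times> real \<times> real \<times> real) measure)" by simp
  then have G_borel [measurable]: "G \<in> borel_measurable borel"
    using H unfolding G_def[abs_def] by (simp add: borel_measurable_restrict_space_iff_ennreal)
  have G_eq: "G (x, r, y0, y1) = H (x, r, y0, y1)" if "0 < y0" "0 < y1" for x r y0 y1
    using that by (simp add: G_def)
  have G_0: "G (x, r, y) = 0" if "y \<notin> quadrant" for x r y
    using that by (auto simp: G_def)
  define F where "F z = G (Re (fst z), Re (snd z) - Re (fst z), Im (fst z), Im (snd z))" for z :: "complex \<times> complex"
  have F_meas [measurable]: "F \<in> borel_measurable (borel \<Otimes>\<^sub>M borel)"
    unfolding F_def by measurable
  \<comment> \<open>The full integrand after thinning and evaluation of the determinant. It vanishes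
    unless both heights are positive, which absorbs the restrictions to
    \<open>half_plane\<close>.\<close>
  define \<Psi> where "\<Psi> x r y0 y1 = G (x, r, y0, y1) * ennreal (W y0 * W y1) * ennreal (kappa r (y0, y1))"
    for x r y0 y1
  have \<Psi>_meas: "(\<lambda>(x, r, y0, y1). \<Psi> x r y0 y1) \<in> borel_measurable (borel \<Otimes>\<^sub>M borel \<Otimes>\<^sub>M borel \<Otimes>\<^sub>M borel)"
    unfolding \<Psi>_def case_prod_unfold by measurable

  have "(\<integral>\<^sup>+ \<omega>. (\<integral>\<^sup>+ (z0, z1). H (Re z0, Re z1 - Re z0, Im z0, Im z1)
            \<partial>count_space {(z0, z1). z0 \<in> M \<omega> \<and> z1 \<in> M \<omega> \<and> z0 \<noteq> z1}) \<partial>P) =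
      (\<integral>\<^sup>+ \<omega>. \<integral>\<^sup>+ z. F z \<partial>count_space (distinct_pairs (M \<omega>)) \<partial>P)"
    unfolding distinct_pairs_def
    using M_subset by (intro nn_integral_cong) (auto simp: F_def half_plane_def subset_eq intro!: G_eq[symmetric])
  also have "\<dots> = (\<integral>\<^sup>+ \<omega>. \<integral>\<^sup>+ z. F z * ennreal (W (Im (fst z)) * W (Im (snd z))) \<partial>count_space (distinct_pairs (Z \<omega>)) \<partial>P)"
    using Z by (intro nn_integral_distinct_pairs_thinning[OF thin])
      (auto simp: W_nonneg W_le_1 half_plane_def subset_eq W_eq)
  also have "\<dots> = (\<integral>\<^sup>+ z\<in>half_plane. \<integral>\<^sup>+ \<zeta>\<in>half_plane. F (z, \<zeta>) * ennreal (W (Im z) * W (Im \<zeta>)) *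
      ennreal (Re (K_H z z * K_H \<zeta> \<zeta> - K_H z \<zeta> * K_H \<zeta> z)) \<partial>lborel \<partial>lborel)"
    by (subst nn_integral_distinct_pairs_determinantal[OF det, where X = X and I = "\<lambda>\<omega>. {n. enat n < N \<omega>}"])
      (use enum X in \<open>auto simp: case_prod_unfold\<close>)
  also have "\<dots> = (\<integral>\<^sup>+ z. \<integral>\<^sup>+ \<zeta>. \<Psi> (Re z) (Re \<zeta> - Re z) (Im z) (Im \<zeta>) \<partial>lborel \<partial>lborel)"
  proof (intro nn_integral_cong)
    fix z :: complex
    have "(\<integral>\<^sup>+ \<zeta>\<in>half_plane. F (z, \<zeta>) * ennreal (W (Im z) * W (Im \<zeta>)) *
        ennreal (Re (K_H z z * K_H \<zeta> \<zeta> - K_H z \<zeta> * K_H \<zeta> z)) \<partial>lborel) * indicator half_plane z =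
        (\<integral>\<^sup>+ \<zeta>. (F (z, \<zeta>) * ennreal (W (Im z) * W (Im \<zeta>)) *
        ennreal (Re (K_H z z * K_H \<zeta> \<zeta> - K_H z \<zeta> * K_H \<zeta> z)) * indicator half_plane \<zeta>) * indicator half_plane z \<partial>lborel)"
      by (rule nn_integral_multc[symmetric]) measurable
    also have "\<dots> = (\<integral>\<^sup>+ \<zeta>. \<Psi> (Re z) (Re \<zeta> - Re z) (Im z) (Im \<zeta>) \<partial>lborel)"
      unfolding K_H_two_point
      by (intro nn_integral_cong) (auto simp: F_def \<Psi>_def half_plane_def G_0 split: split_indicator)
    finally show "(\<integral>\<^sup>+ \<zeta>\<in>half_plane. F (z, \<zeta>) * ennreal (W (Im z) * W (Im \<zeta>)) *
        ennreal (Re (K_H z z * K_H \<zeta> \<zeta> - K_H z \<zeta> * K_H \<zeta> z)) \<partial>lborel) * indicator half_plane z =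
        (\<integral>\<^sup>+ \<zeta>. \<Psi> (Re z) (Re \<zeta> - Re z) (Im z) (Im \<zeta>) \<partial>lborel)" .
  qed
  \<comment> \<open>Splitting each complex variable into real and imaginary part yields the order
    x0, y0, x1, y1 that \<open>nn_integral_shear\<close> expects.\<close>
  also have "\<dots> = (\<integral>\<^sup>+ x0. \<integral>\<^sup>+ y0. \<integral>\<^sup>+ x1. \<integral>\<^sup>+ y1. \<Psi> x0 (x1 - x0) y0 y1 \<partial>lborel \<partial>lborel \<partial>lborel \<partial>lborel)"
  proof -
    have m: "(\<lambda>z. \<Psi> (Re (fst z)) (Re (snd z) - Re (fst z)) (Im (fst z)) (Im (snd z))) \<in> borel_measurable (borel \<Otimes>\<^sub>M lborel)"
      unfolding \<Psi>_def by measurable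
    have "(\<lambda>z. \<integral>\<^sup>+ \<zeta>. \<Psi> (Re z) (Re \<zeta> - Re z) (Im z) (Im \<zeta>) \<partial>lborel) \<in> borel_measurable borel"
      using lborel.borel_measurable_nn_integral_fst[OF m] by simp
    moreover have "(\<lambda>\<zeta>. \<Psi> x (Re \<zeta> - x) y (Im \<zeta>)) \<in> borel_measurable borel" for x y
      unfolding \<Psi>_def by measurable
    ultimately show ?thesis by (simp add: nn_integral_lborel_complex)
  qed
  also have "\<dots> = (\<integral>\<^sup>+ x. \<integral>\<^sup>+ r. \<integral>\<^sup>+ y0. \<integral>\<^sup>+ y1. \<Psi> x r y0 y1 \<partial>lborel \<partial>lborel \<partial>lborel \<partial>lborel)"
    by (rule nn_integral_shear[OF \<Psi>_meas])
  also have "\<dots> = (\<integral>\<^sup>+ x. \<integral>\<^sup>+ r. ennreal (rho2 w r) * (\<integral>\<^sup>+ (y0, y1). H (x, r, y0, y1) \<partial>Q w r) \<partial>lborel \<partial>lborel)"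
  proof (intro nn_integral_cong)
    fix x r :: real
    have "(\<integral>\<^sup>+ (y0, y1). H (x, r, y0, y1) \<partial>Q w r) = (\<integral>\<^sup>+ y. G (x, r, y) \<partial>Q w r)"
      by (intro nn_integral_cong) (auto simp: space_Q G_eq)
    moreover have "(\<lambda>y. G (x, r, y)) \<in> borel_measurable borel" by measurable
    ultimately show "(\<integral>\<^sup>+ y0. \<integral>\<^sup>+ y1. \<Psi> x r y0 y1 \<partial>lborel \<partial>lborel) =
        ennreal (rho2 w r) * (\<integral>\<^sup>+ (y0, y1). H (x, r, y0, y1) \<partial>Q w r)"
      using nn_integral_Q[of "\<lambda>y. G (x, r, y)" r] G_0 by (simp add: \<Psi>_def)
  qed
  finally show "(\<integral>\<^sup>+ \<omega>. (\<integral>\<^sup>+ (z0, z1). H (Re z0, Re z1 - Re z0, Im z0, Im z1)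
            \<partial>count_space {(z0, z1). z0 \<in> M \<omega> \<and> z1 \<in> M \<omega> \<and> z0 \<noteq> z1}) \<partial>P) =
      (\<integral>\<^sup>+ x. \<integral>\<^sup>+ r. ennreal (rho2 w r) * (\<integral>\<^sup>+ (y0, y1). H (x, r, y0, y1) \<partial>Q w r) \<partial>lborel \<partial>lborel)" .
qed

end

theorem proposition1p2:
  fixes P :: "'a measure" and Z M :: "'a \<Rightarrow> complex set"
    and \<alpha> \<beta> :: real and w :: "real \<Rightarrow> real"
  assumes "0 < \<alpha>" and "\<alpha> < \<beta>" and "w \<in> weights \<alpha> \<beta>"
    and "determinantal_process P half_plane K_H Z"
    and "independent_thinning P Z (\<lambda>z. w (Im z)) M"
  shows "pair_disintegration P M w (Q w) \<and>
    tv_continuous (Q w) \<and>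
    prob_family_on quadrant (Q w) \<and> weakly_continuous_on quadrant (Q w) \<and>
    (\<forall>q. prob_family_on quadrant q \<and> weakly_continuous_on quadrant q \<and>
         pair_disintegration P M w q \<longrightarrow> (\<forall>r. q r = Q w r))"
proof -
  interpret height_weight \<alpha> \<beta> w using assms by unfold_locales
  have dis: "pair_disintegration P M w (Q w)"
    using assms by (intro pair_disintegration_Q)
  then show ?thesis
    using tv_continuous_Q prob_family_Q weakly_continuous_Q
      pair_disintegration_unique[OF _ _ _ prob_family_Q weakly_continuous_Q dis] by blast
qed

end
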